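(* Assume that the likelihood function $L_n(\theta;\mathbf x)$ has a single global maximizer $\hat\theta_n$. Define the average loglikelihood $\bar\ell_n(\theta)=\ell_n(\theta)/n$. Assume that there are $\epsilon>0$ and $\delta>0$, independent of $n$, such that $\bar\ell_n$ and the log prior density $\log\pi$ have six continuous derivatives in the neighborhood $(\hat\theta_n-\epsilon,\hat\theta_n+\epsilon)$, such that $\bar\ell_n(\theta)<\bar\ell_n(\hat\theta_n)-\delta$ for $\theta\notin(\hat\theta_n-\epsilon,\hat\theta_n+\epsilon)$, and such that the second derivative of the average loglikelihood is bounded away from zero on this neighborhood. Suppose also that the Bernstein--von Mises property stated in the context holds. Let $\theta_0$ and $\sigma$ be the expectation and standard deviation of the posterior distribution of $\theta$, respectively, and let the invariant cumulant $\kappa_j$ of $\theta$ of order $j$ be the cumulant of order $j$ of $(\theta-\theta_0)/\sigma$ under the posterior distribution. Then, as $n\to\infty$, $\kappa_j=O(n^{(2-j)/2})$ for $j\in\{3,4,5\}$.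
   Context: Setting. Conditionally on a scalar random parameter $\theta$ with values in $\Theta\subset\mathbb R$, the random variables $X_1,X_2,\dots$ are independent and identically distributed with density $f(x\mid\theta)$. The data $\mathbf x$ are observations of $X^{(n)}=(X_1,\dots,X_n)$, regarded as the initial segment of a given, fixed, well-behaved infinite sequence of realizations, so that asymptotic statements as $n\to\infty$ are deterministic statements about that sequence. The likelihood is $L_n(\theta;\mathbf x)=\prod_{i=1}^n f(x_i\mid\theta)$ and the loglikelihood is $\ell_n(\theta)=\ell_n(\theta;\mathbf x)=\log L_n(\theta;\mathbf x)$; derivatives are with respect to $\theta$. The prior density is $\pi(\theta)$. The posterior density of $\theta$ is $$f(\theta\mid\mathbf x)=\frac{L_n(\theta;\mathbf x)\pi(\theta)}{\int_\Theta L_n(t;\mathbf x)\pi(t)\,dt}.$$ The quantities $\theta_0,\sigma,\kappa_j$ depend on $n$ and $\mathbf x$. "Bounded away from zero" is meant uniformly in $n$. Bernstein--von Mises property (standing assumption): the total variation distance between the posterior distribution of $(\theta-\theta_0)/\sigma$ and the standard normal distribution tends to $0$ as $n\to\infty$.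
   Formalization: Added, since the cumulants may otherwise not exist or the rate fail: the maximizers stay bounded; derivatives of orders 1–6 of the average loglikelihood are bounded on the neighborhoods, uniformly for large n; for some p>5 the posterior absolute p-th moments are bounded for large n. *)

theory Defs
  imports "HOL-Probability.Probability" "HOL-Computational_Algebra.Formal_Power_Series"
begin

(* M is the reference measure on the sample space; given \<theta>, each observation has density
   f _ \<theta> with respect to M. The conditional i.i.d. structure enters through the product form of
   the likelihood below. *)
locale bayes_model =
  fixes M :: "'a measure" and \<Theta> :: "real set" and f :: "'a \<Rightarrow> real \<Rightarrow> real" and prior :: "real \<Rightarrow> real"
  assumes \<Theta>_borel: "\<Theta> \<in> sets borel"
    and f_measurable: "(\<lambda>(y, \<theta>). f y \<theta>) \<in> borel_measurable (M \<Otimes>\<^sub>M restrict_space borel \<Theta>)"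
    and f_nonneg: "\<And>y \<theta>. y \<in> space M \<Longrightarrow> \<theta> \<in> \<Theta> \<Longrightarrow> 0 \<le> f y \<theta>"
    and f_density: "\<And>\<theta>. \<theta> \<in> \<Theta> \<Longrightarrow> (\<integral>\<^sup>+y. ennreal (f y \<theta>) \<partial>M) = 1"
    and prior_measurable: "set_borel_measurable borel \<Theta> prior"
    and prior_nonneg: "\<And>\<theta>. \<theta> \<in> \<Theta> \<Longrightarrow> 0 \<le> prior \<theta>"
    and prior_density: "(\<integral>\<^sup>+\<theta>\<in>\<Theta>. ennreal (prior \<theta>) \<partial>lborel) = 1"

definition likelihood :: "('a \<Rightarrow> real \<Rightarrow> real) \<Rightarrow> (nat \<Rightarrow> 'a) \<Rightarrow> nat \<Rightarrow> real \<Rightarrow> real" where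
  "likelihood f x n \<theta> = (\<Prod>i=1..n. f (x i) \<theta>)"

(* Where the likelihood vanishes the loglikelihood is -\<infinity>, but ln 0 = 0 here; statements about
   these functions therefore have to be guarded by positivity of the likelihood. *)
definition loglik :: "('a \<Rightarrow> real \<Rightarrow> real) \<Rightarrow> (nat \<Rightarrow> 'a) \<Rightarrow> nat \<Rightarrow> real \<Rightarrow> real" where
  "loglik f x n \<theta> = ln (likelihood f x n \<theta>)"

definition avg_loglik :: "('a \<Rightarrow> real \<Rightarrow> real) \<Rightarrow> (nat \<Rightarrow> 'a) \<Rightarrow> nat \<Rightarrow> real \<Rightarrow> real" where
  "avg_loglik f x n \<theta> = loglik f x n \<theta> / real n"

definition unique_global_maximizer :: "('b \<Rightarrow> real) \<Rightarrow> 'b set \<Rightarrow> 'b \<Rightarrow> bool" where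
  "unique_global_maximizer g S t \<longleftrightarrow> t \<in> S \<and> (\<forall>s\<in>S. s \<noteq> t \<longrightarrow> g s < g t)"

(* Meant for open S. *)
definition Ck_on :: "nat \<Rightarrow> (real \<Rightarrow> real) \<Rightarrow> real set \<Rightarrow> bool" where
  "Ck_on k g S \<longleftrightarrow>
     (\<forall>j<k. \<forall>t\<in>S. (deriv ^^ j) g differentiable (at t)) \<and> continuous_on S ((deriv ^^ k) g)"

definition posterior_density ::
  "real set \<Rightarrow> ('a \<Rightarrow> real \<Rightarrow> real) \<Rightarrow> (real \<Rightarrow> real) \<Rightarrow> (nat \<Rightarrow> 'a) \<Rightarrow> nat \<Rightarrow> real \<Rightarrow> real" where
  "posterior_density \<Theta> f prior x n \<theta> =
     indicator \<Theta> \<theta> * (likelihood f x n \<theta> * prior \<theta>)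
       / (LINT t:\<Theta>|lborel. likelihood f x n t * prior t)"

definition posterior ::
  "real set \<Rightarrow> ('a \<Rightarrow> real \<Rightarrow> real) \<Rightarrow> (real \<Rightarrow> real) \<Rightarrow> (nat \<Rightarrow> 'a) \<Rightarrow> nat \<Rightarrow> real measure" where
  "posterior \<Theta> f prior x n = density lborel (\<lambda>\<theta>. ennreal (posterior_density \<Theta> f prior x n \<theta>))"

definition mean :: "real measure \<Rightarrow> real" where
  "mean P = (LINT t|P. t)"

definition std_dev :: "real measure \<Rightarrow> real" where
  "std_dev P = sqrt (LINT t|P. (t - mean P)\<^sup>2)"

definition standardized :: "real measure \<Rightarrow> real measure" where
  "standardized P = distr P borel (\<lambda>t. (t - mean P) / std_dev P)"

(* Coefficients of the formal cumulant generating function: with m(X) = \<Sum>\<^sub>k E[Z^k] X^k / k!,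
   ln m(X) = \<Sum>\<^sub>j \<kappa>\<^sub>j X^j / j!. The j-th coefficient involves moments of order at most j only, so it
   is meaningful as soon as the j-th absolute moment is finite, without exponential moments.
   fps_ln 1 is the series of ln (1 + X). *)
definition cumulant :: "real measure \<Rightarrow> nat \<Rightarrow> real" where
  "cumulant P j =
     fact j * fps_nth (fps_ln 1 oo (Abs_fps (\<lambda>k. (LINT t|P. t ^ k) / fact k) - 1)) j"

definition invariant_cumulant :: "real measure \<Rightarrow> nat \<Rightarrow> real" where
  "invariant_cumulant P j = cumulant (standardized P) j"

(* For probability measures on the same \<sigma>-algebra. *)
definition tv_dist :: "'b measure \<Rightarrow> 'b measure \<Rightarrow> real" where
  "tv_dist P Q = (SUP A\<in>sets P. \<bar>measure P A - measure Q A\<bar>)"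

end

(* Integration by parts against the posterior density. Let m and s be the posterior mean and standard
   deviation, w = (theta - m) / s, and restrict to an interval J of fixed length around the maximizer,
   outside of which the posterior is exponentially small. Expanding the derivative of the log posterior
   density around m, the identity E[H'(theta) w^k] = -k E[w^(k-1)] / s on J becomes
     a0 nu_k + a1 nu_(k+1) + a2 nu_(k+2) + a3 nu_(k+3) + k nu_(k-1) = O(n^(-3/2)),
   with nu_k = E[w^k; J], a0, a1 = O(1), a2 = O(n^(-1/2)) and a3 = O(1/n), because s is exactly of order
   n^(-1/2). Since nu_0, nu_1, nu_2 are 1, 0, 1 up to O(n^(-3/2)), these linear relations alone give
   nu_3 = 2 a2 and nu_5 = 20 a2 up to O(n^(-3/2)) and nu_4 = 3 up to O(1/n), so that the cumulants nu_3,
   nu_4 - 3 and nu_5 - 10 nu_3 have the claimed orders. *)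
theory Submission
  imports Defs "HOL-Real_Asymp.Real_Asymp"
begin

text \<open>Only a moment of some order p > 5 is assumed of the posterior, while the relation for k
  = 6 already involves \<open>\<nu> 9\<close>. This forces the restriction to \<open>J\<close>:
  there a multiple of a normal density dominates, so moments of every order are bounded, and the
  truncation error has to be controlled only up to order 5.

  The coefficients a0 and a1 are never expanded explicitly. Standardization fixes nu_0, nu_1, nu_2,
  and the relations for k = 0 and k = 1 then determine a0 and a1. Only the order of s needs a
  separate proof, and the same domination supplies it: it bounds the second moment about the
  maximizer by a multiple of 1/n, and it caps the density at order sqrt n, so that the mass cannot
  sit on an interval much shorter than n^(-1/2).

  The order of the fifth cumulant rests on parity. Odd moments are O(n^(-1/2)), which pushes a3
  nu_3, a3 nu_5 and a3 nu_7 down to the error level; a2 is then the only parameter left in nu_3 and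
  nu_5, and it cancels.\<close>

section \<open>Cumulants from the moment recurrence\<close>

text \<open>With mean 0 and variance 1 the series \<open>b\<close> starts at order 2, so up to order
  5 the logarithm is b - b^2/2. The coefficients of b^2/2 at orders 4 and 5 are 1/8 and m3/12, with
  m3 the third moment; multiplied by 4! and 5! they give 3 and 10 m3.\<close>

lemma cumulants_of_standardized_moments:
  assumes "(LINT z|P. z ^ 0) = 1" "(LINT z|P. z ^ 1) = 0" "(LINT z|P. z ^ 2) = 1"
  shows "cumulant P 3 = (LINT z|P. z ^ 3)"
    and "cumulant P 4 = (LINT z|P. z ^ 4) - 3"
    and "cumulant P 5 = (LINT z|P. z ^ 5) - 10 * (LINT z|P. z ^ 3)"
proof -
  define b where "b = Abs_fps (\<lambda>k. (LINT z|P. z ^ k) / fact k) - 1"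
  have b: "fps_nth b 0 = 0" "fps_nth b (Suc 0) = 0" "fps_nth b 2 = 1 / 2" "fps_nth b k = (LINT z|P. z ^ k) / fact k" if "k \<ge> 3" for k
    using assms that by (auto simp: b_def)
  have b2: "fps_nth b (Suc (Suc 0)) = 1 / 2" using b(3)[of 3] by (simp add: numeral_2_eq_2)
  note sums = numeral_eq_Suc fps_mult_nth fps_ln_nth fps_compose_nth
  show "cumulant P 3 = (LINT z|P. z ^ 3)"
    unfolding cumulant_def b_def[symmetric]
    using b(4)[of 3] by (simp add: sums b(1,2)[of 3] b2)
  show "cumulant P 4 = (LINT z|P. z ^ 4) - 3"
    unfolding cumulant_def b_def[symmetric]
    using b(4)[of 4] by (simp add: sums b(1,2)[of 3] b2 field_simps)
  show "cumulant P 5 = (LINT z|P. z ^ 5) - 10 * (LINT z|P. z ^ 3)"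
    unfolding cumulant_def b_def[symmetric]
    using b(4)[of 5] b(4)[of 3] by (simp add: sums b(1,2)[of 3] b2 field_simps)
qed

text \<open>A bootstrap in powers of \<open>e\<close>, which stands for n^(-1/2). To first order the
  relations are those of the standard normal moments, which makes odd moments small; fed back into
  the same relations, this parity gains one order in each further round. Nothing but boundedness is
  assumed of \<open>a0\<close> and \<open>a1\<close>, since the relations themselves pin them
  down.\<close>

lemma stein_recurrence_cumulants:
  fixes e a0 a1 a2 a3 :: "nat \<Rightarrow> real" and \<nu> :: "nat \<Rightarrow> nat \<Rightarrow> real"
  assumes e: "e \<in> O(\<lambda>_. 1)"
    and nu_bd: "\<And>k. \<nu> k \<in> O(\<lambda>_. 1)"
    and nu0: "(\<lambda>n. \<nu> 0 n - 1) \<in> O(\<lambda>n. e n ^ 3)"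
    and nu1: "\<nu> 1 \<in> O(\<lambda>n. e n ^ 3)"
    and nu2: "(\<lambda>n. \<nu> 2 n - 1) \<in> O(\<lambda>n. e n ^ 3)"
    and a: "a0 \<in> O(\<lambda>_. 1)" "a1 \<in> O(\<lambda>_. 1)" "a2 \<in> O(e)" "a3 \<in> O(\<lambda>n. e n ^ 2)"
    and rec: "\<And>k. (\<lambda>n. a0 n * \<nu> k n + a1 n * \<nu> (k+1) n + a2 n * \<nu> (k+2) n + a3 n * \<nu> (k+3) n
                    + real k * \<nu> (k - 1) n) \<in> O(\<lambda>n. e n ^ 3)"
  shows "\<nu> 3 \<in> O(e)" "(\<lambda>n. \<nu> 4 n - 3) \<in> O(\<lambda>n. e n ^ 2)"
    "(\<lambda>n. \<nu> 5 n - 10 * \<nu> 3 n) \<in> O(\<lambda>n. e n ^ 3)"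
proof -
  \<comment> \<open>A calculus graded by powers of \<open>e\<close>. Each estimate below writes its
    target as a combination of quantities of known order, and \<open>cong\<close> leaves only a
    polynomial identity to check.\<close>
  define Oe where "Oe i g \<longleftrightarrow> g \<in> O(\<lambda>n. e n ^ i)" for i and g :: "nat \<Rightarrow> real"
  have mono: "Oe i g" if "Oe j g" "i \<le> j" for i j g
  proof -
    have "(\<lambda>n. e n ^ i * e n ^ (j - i)) \<in> O(\<lambda>n. e n ^ i * 1 ^ (j - i))"
      by (intro landau_o.big.mult landau_o.big_power e) auto
    then have "(\<lambda>n. e n ^ j) \<in> O(\<lambda>n. e n ^ i)"
      using that(2) by (simp flip: power_add)
    then show ?thesis using that(1) unfolding Oe_def by (rule landau_o.big_trans[rotated])
  qed
  have add: "Oe i (\<lambda>n. g n + h n)" if "Oe i g" "Oe i h" for i g h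
    using that unfolding Oe_def by (rule sum_in_bigo)
  have diff: "Oe i (\<lambda>n. g n - h n)" if "Oe i g" "Oe i h" for i g h
    using that unfolding Oe_def by (rule sum_in_bigo)
  have mult: "Oe k (\<lambda>n. g n * h n)" if "Oe i g" "Oe j h" "k \<le> i + j" for i j k g h
  proof -
    have "Oe (i + j) (\<lambda>n. g n * h n)"
      using landau_o.big.mult[OF that(1,2)[unfolded Oe_def]] by (simp add: Oe_def power_add)
    then show ?thesis using that(3) by (rule mono)
  qed
  have const: "Oe 0 (\<lambda>n. c)" for c by (simp add: Oe_def)
  have cmult: "Oe i (\<lambda>n. c * g n)" if "Oe i g" for i g c
    using mult[OF const that, of i c] by simp
  have cong: "Oe i h" if "Oe i g" "\<And>n. h n = g n" for i g h
  proof -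
    have "h = g" using that(2) by auto
    then show ?thesis using that(1) by simp
  qed
  have N: "Oe 0 (\<nu> k)" for k using nu_bd by (simp add: Oe_def)
  have A: "Oe 0 a0" "Oe 0 a1" "Oe 1 a2" "Oe 2 a3" using a by (simp_all add: Oe_def)
  have N0: "Oe 3 (\<lambda>n. \<nu> 0 n - 1)" and N1: "Oe 3 (\<nu> 1)" and N2: "Oe 3 (\<lambda>n. \<nu> 2 n - 1)"
    using nu0 nu1 nu2 by (simp_all add: Oe_def)
  have R: "Oe 3 (\<lambda>n. a0 n * \<nu> k n + a1 n * \<nu> (k+1) n + a2 n * \<nu> (k+2) n + a3 n * \<nu> (k+3) n
                    + real k * \<nu> (k - 1) n)" for k
    using rec by (simp add: Oe_def)
  have R0: "Oe 3 (\<lambda>n. a0 n * \<nu> 0 n + a1 n * \<nu> 1 n + a2 n * \<nu> 2 n + a3 n * \<nu> 3 n)"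
    using R[of 0] by (simp add: numeral_2_eq_2)
  have R1: "Oe 3 (\<lambda>n. a0 n * \<nu> 1 n + a1 n * \<nu> 2 n + a2 n * \<nu> 3 n + a3 n * \<nu> 4 n + \<nu> 0 n)"
    using R[of 1] by (simp add: numeral_eq_Suc)
  have R2: "Oe 3 (\<lambda>n. a0 n * \<nu> 2 n + a1 n * \<nu> 3 n + a2 n * \<nu> 4 n + a3 n * \<nu> 5 n + 2 * \<nu> 1 n)"
    using R[of 2] by simp
  have R3: "Oe 3 (\<lambda>n. a0 n * \<nu> 3 n + a1 n * \<nu> 4 n + a2 n * \<nu> 5 n + a3 n * \<nu> 6 n + 3 * \<nu> 2 n)"
    using R[of 3] by simp
  have R4: "Oe 3 (\<lambda>n. a0 n * \<nu> 4 n + a1 n * \<nu> 5 n + a2 n * \<nu> 6 n + a3 n * \<nu> 7 n + 4 * \<nu> 3 n)"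
    using R[of 4] by simp
  have R5: "Oe 3 (\<lambda>n. a0 n * \<nu> 5 n + a1 n * \<nu> 6 n + a2 n * \<nu> 7 n + a3 n * \<nu> 8 n + 5 * \<nu> 4 n)"
    using R[of 5] by simp
  have R6: "Oe 3 (\<lambda>n. a0 n * \<nu> 6 n + a1 n * \<nu> 7 n + a2 n * \<nu> 8 n + a3 n * \<nu> 9 n + 6 * \<nu> 5 n)"
    using R[of 6] by simp
  have a2N: "Oe 1 (\<lambda>n. a2 n * \<nu> k n)" for k by (rule mult[OF A(3) N]) simp
  have a3N: "Oe 2 (\<lambda>n. a3 n * \<nu> k n)" for k by (rule mult[OF A(4) N]) simp
  have a3N1: "Oe 1 (\<lambda>n. a3 n * \<nu> k n)" for k by (rule mono[OF a3N]) simp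
  \<comment> \<open>To order \<open>e\<close> the terms with \<open>a2\<close> and \<open>a3\<close>
    are absorbed by the error, since all moments are bounded. The cases k = 0 and k = 1 then give a0
    = 0 and a1 = -1 to this order.\<close>
  have R_1: "Oe 1 (\<lambda>n. a0 n * \<nu> k n + a1 n * \<nu> (k+1) n + real k * \<nu> (k - 1) n)" for k
    by (rule cong[OF diff[OF diff[OF mono[OF R[of k], of 1] a2N[of "k+2"]] a3N1[of "k+3"]]]) simp_all
  have a0_err: "Oe 3 (\<lambda>n. a0 n * (\<nu> 0 n - 1))" "Oe 3 (\<lambda>n. a0 n * (\<nu> 2 n - 1))" "Oe 3 (\<lambda>n. a0 n * \<nu> 1 n)"
    and a1_err: "Oe 3 (\<lambda>n. a1 n * \<nu> 1 n)" "Oe 3 (\<lambda>n. a1 n * (\<nu> 2 n - 1))"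
    and a2_err: "Oe 3 (\<lambda>n. a2 n * (\<nu> 2 n - 1))"
    by (rule mult[OF A(1) N0] mult[OF A(1) N1] mult[OF A(1) N2] mult[OF A(2) N1] mult[OF A(2) N2]
        mult[OF A(3) N2], simp)+
  have a0: "Oe 1 a0"
    by (rule cong[OF diff[OF diff[OF R_1[of 0] mono[OF a0_err(1)]] mono[OF a1_err(1)]]])
      (simp_all add: algebra_simps)
  have a1: "Oe 1 (\<lambda>n. a1 n + 1)"
    by (rule cong[OF diff[OF diff[OF diff[OF R_1[of 1] mono[OF a0_err(3)]] mono[OF a1_err(2)]] mono[OF N0]]])
      (simp_all add: algebra_simps numeral_2_eq_2)
  \<comment> \<open>With a0 = 0 and a1 = -1 to order \<open>e\<close>, the relation reads nu_(k+1) =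
    k nu_(k-1), the recurrence of the normal moments. Smallness spreads from nu_1 to nu_3, nu_5,
    nu_7.\<close>
  have odd_step: "Oe 1 (\<nu> (k + 1))" if "Oe 1 (\<lambda>n. real k * \<nu> (k - 1) n)" for k
    by (rule cong[OF diff[OF add[OF that mult[OF a0 N[of k], of 1]]
          diff[OF R_1[of k] mult[OF a1 N[of "k+1"], of 1]]]]) (simp_all add: algebra_simps)
  have v3: "Oe 1 (\<nu> 3)"
    using odd_step[of 2] cmult[OF mono[OF N1], of 1 2] by simp
  have v5: "Oe 1 (\<nu> 5)"
    using odd_step[of 4] cmult[OF v3, of 4] by simp
  have v7: "Oe 1 (\<nu> 7)"
    using odd_step[of 6] cmult[OF v5, of 6] by simp
  have a2_odd: "Oe 2 (\<lambda>n. a2 n * \<nu> 3 n)" "Oe 2 (\<lambda>n. a2 n * \<nu> 5 n)" "Oe 2 (\<lambda>n. a2 n * \<nu> 7 n)"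
    by (rule mult[OF A(3) v3] mult[OF A(3) v5] mult[OF A(3) v7], simp)+
  have a0_odd: "Oe 2 (\<lambda>n. a0 n * \<nu> 3 n)" "Oe 2 (\<lambda>n. a0 n * \<nu> 5 n)"
    by (rule mult[OF a0 v3] mult[OF a0 v5], simp)+
  have a3_odd: "Oe 3 (\<lambda>n. a3 n * \<nu> 3 n)" "Oe 3 (\<lambda>n. a3 n * \<nu> 5 n)" "Oe 3 (\<lambda>n. a3 n * \<nu> 7 n)"
    by (rule mult[OF A(4) v3] mult[OF A(4) v5] mult[OF A(4) v7], simp)+
  \<comment> \<open>In the relation k = 1 the correction a2 nu_3 is of second order because nu_3 is
    odd.\<close>
  have a1': "Oe 2 (\<lambda>n. a1 n + 1)"
    by (rule cong[OF diff[OF diff[OF diff[OF diff[OF diff[OF mono[OF R1] mono[OF a0_err(3)]] mono[OF a1_err(2)]]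
            mono[OF N0]] a2_odd(1)] a3N[of 4]]])
      (simp_all add: algebra_simps)
  \<comment> \<open>In the relation k = 0 the term a3 nu_3 is of third order, again by parity, so a0
    = -a2 at full accuracy.\<close>
  have a0': "Oe 3 (\<lambda>n. a0 n + a2 n)"
    by (rule cong[OF diff[OF diff[OF diff[OF diff[OF R0 a0_err(1)] a1_err(1)] a2_err] a3_odd(1)]])
      (simp_all add: algebra_simps)
  have v4: "Oe 2 (\<lambda>n. \<nu> 4 n - 3)"
    by (rule cong[OF diff[OF add[OF add[OF add[OF a0_odd(1) a2_odd(2)] a3N[of 6]]
            add[OF mult[OF a1' N[of 4], of 2] cmult[OF mono[OF N2], of 2 3]]] mono[OF R3]]])
      (simp_all add: algebra_simps)
  have v6: "Oe 2 (\<lambda>n. \<nu> 6 n - 15)"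
    by (rule cong[OF diff[OF add[OF add[OF add[OF a0_odd(2) a2_odd(3)] a3N[of 8]]
            add[OF mult[OF a1' N[of 6], of 2] cmult[OF v4, of 5]]] mono[OF R5]]])
      (simp_all add: algebra_simps)
  \<comment> \<open>The relation k = 2 with nu_2 = 1 and nu_4 = 3 reads a0 - nu_3 + 3 a2 = 0;
    inserting a0 = -a2 leaves nu_3 = 2 a2.\<close>
  have v3': "Oe 3 (\<lambda>n. \<nu> 3 n - 2 * a2 n)"
    by (rule cong[OF diff[OF add[OF add[OF add[OF a0' a0_err(2)] mult[OF a1' v3, of 3]]
            add[OF add[OF mult[OF A(3) v4, of 3] a3_odd(2)] cmult[OF N1, of 2]]] R2]])
      (simp_all add: algebra_simps)
  \<comment> \<open>The relation k = 4 with nu_4 = 3 and nu_6 = 15 reads 3 a0 - nu_5 + 15 a2 + 4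
    nu_3 = 0; the 12 is 15 - 3.\<close>
  have v5': "Oe 3 (\<lambda>n. \<nu> 5 n - 4 * \<nu> 3 n - 12 * a2 n)"
    by (rule cong[OF diff[OF add[OF add[OF cmult[OF a0', of 3] mult[OF a0 v4, of 3]]
            add[OF mult[OF a1' v5, of 3] add[OF mult[OF A(3) v6, of 3] a3_odd(3)]]] R4]])
      (simp_all add: algebra_simps)
  show "\<nu> 3 \<in> O(e)" "(\<lambda>n. \<nu> 4 n - 3) \<in> O(\<lambda>n. e n ^ 2)"
    using v3 v4 by (simp_all add: Oe_def)
  \<comment> \<open>Subtracting six times nu_3 - 2 a2 eliminates \<open>a2\<close>.\<close>
  have "Oe 3 (\<lambda>n. \<nu> 5 n - 10 * \<nu> 3 n)"
    by (rule cong[OF diff[OF v5' cmult[OF v3', of 6]]]) (simp_all add: algebra_simps)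
  then show "(\<lambda>n. \<nu> 5 n - 10 * \<nu> 3 n) \<in> O(\<lambda>n. e n ^ 3)" by (simp add: Oe_def)
qed

section \<open>Absolute moments and peak height of normal densities\<close>

text \<open>The point is that \<open>C\<close> depends on \<open>k\<close> alone: for
  \<open>\<sigma>\<close> of order n^(-1/2), domination by a normal density becomes a moment bound
  of order n^(-k/2).\<close>

lemma normal_abs_moment_scaling:
  obtains C where "0 < C"
    "\<And>\<mu> \<sigma>. 0 < \<sigma> \<Longrightarrow> (LINT x|lborel. normal_density \<mu> \<sigma> x * \<bar>x - \<mu>\<bar> ^ k) = C * \<sigma> ^ k"
proof (cases "even k")
  case True
  then obtain j where k: "k = 2 * j" by (rule evenE)
  have "(LINT x|lborel. normal_density \<mu> \<sigma> x * \<bar>x - \<mu>\<bar> ^ k) = fact (2 * j) / (2 ^ j * fact j) * \<sigma> ^ k"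
    if "0 < \<sigma>" for \<mu> \<sigma>
  proof -
    have "\<bar>x - \<mu>\<bar> ^ k = (x - \<mu>) ^ (2 * j)" for x by (simp add: k power_even_abs)
    moreover have "(\<sigma> ^ j)\<^sup>2 = \<sigma>\<^sup>2 ^ j" by (simp flip: power_mult add: mult.commute)
    ultimately show ?thesis
      using integral_normal_moment_even[OF that, of \<mu> j] that
      by (simp add: k power_mult power_divide mult.commute divide_simps)
  qed
  then show ?thesis by (intro that[of "fact (2 * j) / (2 ^ j * fact j)"]) auto
next
  case False
  then obtain j where k: "k = 2 * j + 1" by (rule oddE)
  have "(LINT x|lborel. normal_density \<mu> \<sigma> x * \<bar>x - \<mu>\<bar> ^ k) = 2 ^ j * fact j * sqrt (2 / pi) * \<sigma> ^ k"
    if "0 < \<sigma>" for \<mu> \<sigma>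
    using integral_normal_moment_abs_odd[OF that, of \<mu> j] that
    by (simp add: k)
  then show ?thesis by (intro that[of "2 ^ j * fact j * sqrt (2 / pi)"]) auto
qed

lemma normal_density_le:
  assumes "0 < \<sigma>" shows "normal_density \<mu> \<sigma> x \<le> exp (- (x - \<mu>)\<^sup>2 / (2 * \<sigma>\<^sup>2)) / \<sigma>"
proof -
  have "1 \<le> sqrt (2 * pi)" using pi_gt3 by simp
  then have "1 / sqrt (2 * pi * \<sigma>\<^sup>2) \<le> 1 / \<sigma>"
    using assms by (simp add: real_sqrt_mult field_simps)
  from mult_right_mono[OF this, of "exp (- (x - \<mu>)\<^sup>2 / (2 * \<sigma>\<^sup>2))"] show ?thesis
    by (simp add: normal_density_def)
qed

section \<open>Densities concentrating at rate \<open>n\<close> to the power \<open>-1/2\<close>\<close>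

text \<open>\<open>D n j\<close> is the \<open>(j + 1)\<close>-st derivative of the logarithm of the density \<open>q n\<close>.\<close>
locale concentrating_densities =
  fixes q :: "nat \<Rightarrow> real \<Rightarrow> real" and t :: "nat \<Rightarrow> real" and D :: "nat \<Rightarrow> nat \<Rightarrow> real \<Rightarrow> real"
    and \<rho> K s B T :: real and N :: nat
  fixes P :: "nat \<Rightarrow> real measure" and J :: "nat \<Rightarrow> real set" and m sd :: "nat \<Rightarrow> real"
  defines "P \<equiv> \<lambda>n. density lborel (\<lambda>\<theta>. ennreal (q n \<theta>))"
    and "J \<equiv> \<lambda>n. {t n - \<rho> .. t n + \<rho>}"
    and "m \<equiv> \<lambda>n. mean (P n)" and "sd \<equiv> \<lambda>n. std_dev (P n)"
  assumes pos: "0 < \<rho>" "0 < K" "0 < s" "0 < B" "0 < T" "0 < N"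
    and q_meas [measurable]: "q n \<in> borel_measurable borel"
    and q_nonneg: "0 \<le> q n \<theta>"
    and prob: "N \<le> n \<Longrightarrow> prob_space (P n)"
    and q_le: "N \<le> n \<Longrightarrow> \<theta> \<in> J n \<Longrightarrow> q n \<theta> \<le> K * normal_density (t n) (s / sqrt n) \<theta>"
    and t_le: "N \<le> n \<Longrightarrow> \<bar>t n\<bar> \<le> T"
    and q_deriv: "N \<le> n \<Longrightarrow> \<theta> \<in> J n \<Longrightarrow> (q n has_real_derivative D n 0 \<theta> * q n \<theta>) (at \<theta>)"
    and D_deriv: "N \<le> n \<Longrightarrow> \<theta> \<in> J n \<Longrightarrow> j < 4 \<Longrightarrow> (D n j has_real_derivative D n (Suc j) \<theta>) (at \<theta>)"
    and D_le: "N \<le> n \<Longrightarrow> \<theta> \<in> J n \<Longrightarrow> j \<in> {1..4} \<Longrightarrow> \<bar>D n j \<theta>\<bar> \<le> B * n"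
    and D_centre: "N \<le> n \<Longrightarrow> \<bar>D n 0 (t n)\<bar> \<le> B"
    and moment: "N \<le> n \<Longrightarrow> integrable (P n) (\<lambda>\<theta>. (1 + \<bar>\<theta>\<bar>) ^ 5)"
    and tail: "N \<le> n \<Longrightarrow> (LINT \<theta>:-J n|P n. (1 + \<bar>\<theta>\<bar>) ^ 5) \<le> min (1 / 4) (K / real n ^ 4)"
begin

section \<open>Location and scale of a concentrating density\<close>

lemma sets_P [measurable_cong, simp]: "sets (P n) = sets borel" and space_P [simp]: "space (P n) = UNIV"
  by (simp_all add: P_def)

lemma J_meas [measurable]: "J n \<in> sets borel"
  by (simp add: J_def)

lemma t_in_J: "t n \<in> J n"
  using pos by (simp add: J_def)

lemma integrable_P: "g \<in> borel_measurable borel \<Longrightarrow> integrable (P n) g \<longleftrightarrow> integrable lborel (\<lambda>\<theta>. q n \<theta> * g \<theta>)"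
  for g :: "real \<Rightarrow> real"
  using integrable_density[of g lborel "q n"] q_nonneg by (simp add: P_def)

lemma integral_P: "g \<in> borel_measurable borel \<Longrightarrow> (LINT \<theta>|P n. g \<theta>) = (LINT \<theta>|lborel. q n \<theta> * g \<theta>)"
  for g :: "real \<Rightarrow> real"
  using integral_density[of g lborel "q n"] q_nonneg by (simp add: P_def)

lemma set_integrable_cont:
  fixes g :: "real \<Rightarrow> real"
  assumes n: "N \<le> n" and g: "continuous_on (J n) g"
  shows "set_integrable (P n) (J n) g"
proof -
  interpret prob_space "P n" by (rule prob[OF n])
  have c: "compact (J n)" by (simp add: J_def)
  then have "bounded (g ` J n)" using g by (metis compact_continuous_image compact_imp_bounded)
  then obtain C where C: "\<And>\<theta>. \<theta> \<in> J n \<Longrightarrow> \<bar>g \<theta>\<bar> \<le> C" "0 \<le> C"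
    unfolding bounded_pos by (metis imageI real_norm_def less_imp_le)
  have "(\<lambda>\<theta>. indicator (J n) \<theta> *\<^sub>R g \<theta>) \<in> borel_measurable borel"
    by (rule borel_measurable_continuous_on_indicator) (use g in auto)
  moreover have "\<bar>indicator (J n) \<theta> *\<^sub>R g \<theta>\<bar> \<le> C" for \<theta>
    using C by (auto split: split_indicator)
  ultimately show ?thesis
    unfolding set_integrable_def by (intro integrable_const_bound[of _ C]) (auto cong: measurable_cong_sets)
qed

lemma moment_bound:
  assumes n: "N \<le> n" and g: "g \<in> borel_measurable borel" and le: "\<And>\<theta>. \<bar>g \<theta>\<bar> \<le> C * (1 + \<bar>\<theta>\<bar>) ^ 5"
  shows "integrable (P n) g" "\<bar>LINT \<theta>:-J n|P n. g \<theta>\<bar> \<le> C * (LINT \<theta>:-J n|P n. (1 + \<bar>\<theta>\<bar>) ^ 5)"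
proof -
  have g': "g \<in> borel_measurable (P n)" using g by simp
  have i: "integrable (P n) (\<lambda>\<theta>. C * (1 + \<bar>\<theta>\<bar>) ^ 5)"
    using moment[OF n] by simp
  show ig: "integrable (P n) g"
    by (rule Bochner_Integration.integrable_bound[OF i g']) (use le in \<open>auto intro: order_trans[OF _ abs_ge_self]\<close>)
  have "\<bar>LINT \<theta>:-J n|P n. g \<theta>\<bar> \<le> (LINT \<theta>:-J n|P n. \<bar>g \<theta>\<bar>)"
    unfolding set_lebesgue_integral_def
    by (rule order_trans[OF integral_abs_bound]) (auto simp: abs_mult)
  also have "\<dots> \<le> (LINT \<theta>:-J n|P n. C * (1 + \<bar>\<theta>\<bar>) ^ 5)"
    using i ig le unfolding set_lebesgue_integral_def
    by (intro integral_mono integrable_mult_indicator integrable_abs) (auto split: split_indicator)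
  finally show "\<bar>LINT \<theta>:-J n|P n. g \<theta>\<bar> \<le> C * (LINT \<theta>:-J n|P n. (1 + \<bar>\<theta>\<bar>) ^ 5)"
    by simp
qed

lemma integral_split:
  fixes g :: "real \<Rightarrow> real"
  assumes "integrable (P n) g"
  shows "(LINT \<theta>|P n. g \<theta>) = (LINT \<theta>:J n|P n. g \<theta>) + (LINT \<theta>:-J n|P n. g \<theta>)"
proof -
  have "(LINT \<theta>|P n. g \<theta>) = (LINT \<theta>|P n. indicator (J n) \<theta> *\<^sub>R g \<theta> + indicator (-J n) \<theta> *\<^sub>R g \<theta>)"
    by (intro Bochner_Integration.integral_cong) (auto split: split_indicator)
  also have "\<dots> = (LINT \<theta>:J n|P n. g \<theta>) + (LINT \<theta>:-J n|P n. g \<theta>)"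
    unfolding set_lebesgue_integral_def using assms
    by (intro Bochner_Integration.integral_add integrable_mult_indicator) auto
  finally show ?thesis .
qed

text \<open>On \<open>J\<close> the density is at most \<open>K\<close> times a normal density
  centred at \<open>t n\<close>, and enlarging the domain of integration to the whole line leaves an
  explicit normal moment. This works for every \<open>k\<close>, whatever moments \<open>P n\<close>
  has.\<close>

lemma local_moment:
  obtains C where "0 < C" "\<And>n. N \<le> n \<Longrightarrow> (LINT \<theta>:J n|P n. \<bar>\<theta> - t n\<bar> ^ k) \<le> C * (1 / sqrt n) ^ k"
proof -
  obtain C where C: "0 < C"
    "\<And>\<mu> \<sigma>. 0 < \<sigma> \<Longrightarrow> (LINT x|lborel. normal_density \<mu> \<sigma> x * \<bar>x - \<mu>\<bar> ^ k) = C * \<sigma> ^ k"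
    using normal_abs_moment_scaling[of k] by blast
  have "(LINT \<theta>:J n|P n. \<bar>\<theta> - t n\<bar> ^ k) \<le> (K * C * s ^ k) * (1 / sqrt n) ^ k" if n: "N \<le> n" for n
  proof -
    have sn: "0 < s / sqrt n" using pos n by simp
    have "set_integrable (P n) (J n) (\<lambda>\<theta>. \<bar>\<theta> - t n\<bar> ^ k)"
      by (intro set_integrable_cont n continuous_intros)
    then have i: "integrable lborel (\<lambda>\<theta>. q n \<theta> * (indicator (J n) \<theta> * \<bar>\<theta> - t n\<bar> ^ k))"
      unfolding set_integrable_def by (subst (asm) integrable_P) auto
    have "(LINT \<theta>:J n|P n. \<bar>\<theta> - t n\<bar> ^ k) = (LINT \<theta>|lborel. q n \<theta> * (indicator (J n) \<theta> * \<bar>\<theta> - t n\<bar> ^ k))"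
      unfolding set_lebesgue_integral_def by (subst integral_P) auto
    also have "\<dots> \<le> (LINT \<theta>|lborel. K * (normal_density (t n) (s / sqrt n) \<theta> * \<bar>\<theta> - t n\<bar> ^ k))"
    proof (intro integral_mono i integrable_mult_right integrable_normal_moment_abs sn)
      fix \<theta>
      show "q n \<theta> * (indicator (J n) \<theta> * \<bar>\<theta> - t n\<bar> ^ k) \<le> K * (normal_density (t n) (s / sqrt n) \<theta> * \<bar>\<theta> - t n\<bar> ^ k)"
        using mult_right_mono[OF q_le[OF n], of \<theta> "\<bar>\<theta> - t n\<bar> ^ k"] pos sn
        by (cases "\<theta> \<in> J n") (auto simp: mult.assoc)
    qed
    also have "\<dots> = (K * C * s ^ k) * (1 / sqrt n) ^ k"
      using C(2)[OF sn] by (simp add: power_divide)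
    finally show ?thesis .
  qed
  then show ?thesis using C(1) pos by (intro that[of "K * C * s ^ k"]) auto
qed

lemma power_le_moment_weight:
  fixes \<theta> c :: real
  assumes "k \<le> 5" "0 \<le> c"
  shows "(\<bar>\<theta>\<bar> + c) ^ k \<le> (1 + c) ^ 5 * (1 + \<bar>\<theta>\<bar>) ^ 5"
proof -
  have "(\<bar>\<theta>\<bar> + c) ^ k \<le> ((1 + c) * (1 + \<bar>\<theta>\<bar>)) ^ k"
    using assms(2) by (intro power_mono) (auto simp: algebra_simps)
  also have "\<dots> \<le> ((1 + c) * (1 + \<bar>\<theta>\<bar>)) ^ 5"
    using assms by (intro power_increasing) (auto simp: algebra_simps)
  finally show ?thesis by (simp add: power_mult_distrib)
qed

lemma integrable_power:
  assumes n: "N \<le> n" and k: "k \<le> 5"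
  shows "integrable (P n) (\<lambda>\<theta>. ((\<theta> - a) / b) ^ k)"
proof (rule moment_bound(1)[OF n])
  show "\<bar>((\<theta> - a) / b) ^ k\<bar> \<le> ((1 + \<bar>a\<bar>) ^ 5 / \<bar>b\<bar> ^ k) * (1 + \<bar>\<theta>\<bar>) ^ 5" for \<theta>
  proof -
    have "\<bar>\<theta> - a\<bar> ^ k \<le> (\<bar>\<theta>\<bar> + \<bar>a\<bar>) ^ k" by (intro power_mono) auto
    also have "\<dots> \<le> (1 + \<bar>a\<bar>) ^ 5 * (1 + \<bar>\<theta>\<bar>) ^ 5" by (rule power_le_moment_weight[OF k]) simp
    finally show ?thesis by (simp add: power_divide power_abs divide_right_mono)
  qed
qed simp

lemma variance_decomposition:
  assumes n: "N \<le> n"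
  shows "(LINT \<theta>|P n. (\<theta> - a)\<^sup>2) = (LINT \<theta>|P n. (\<theta> - m n)\<^sup>2) + (m n - a)\<^sup>2"
proof -
  interpret prob_space "P n" by (rule prob[OF n])
  have i1: "integrable (P n) (\<lambda>\<theta>. \<theta>)" and i2: "integrable (P n) (\<lambda>\<theta>. \<theta>\<^sup>2)"
    using integrable_power[OF n, of 1 0 1] integrable_power[OF n, of 2 0 1] by simp_all
  have *: "(LINT \<theta>|P n. (\<theta> - b)\<^sup>2) = (LINT \<theta>|P n. \<theta>\<^sup>2) - 2 * b * m n + b\<^sup>2" for b
  proof -
    have "(LINT \<theta>|P n. (\<theta> - b)\<^sup>2) = (LINT \<theta>|P n. \<theta>\<^sup>2 - 2 * b * \<theta> + b\<^sup>2)"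
      by (simp add: power2_diff algebra_simps)
    also have "\<dots> = (LINT \<theta>|P n. \<theta>\<^sup>2) - 2 * b * m n + b\<^sup>2"
      using i1 i2 prob_space by (simp add: m_def mean_def)
    finally show ?thesis .
  qed
  show ?thesis unfolding * by (simp add: power2_eq_square algebra_simps)
qed

lemma second_moment_bound:
  obtains C where "0 < C" "\<And>n. N \<le> n \<Longrightarrow> (LINT \<theta>|P n. (\<theta> - t n)\<^sup>2) \<le> C / n"
proof -
  obtain C where C: "0 < C" "\<And>n. N \<le> n \<Longrightarrow> (LINT \<theta>:J n|P n. \<bar>\<theta> - t n\<bar> ^ 2) \<le> C * (1 / sqrt n) ^ 2"
    using local_moment[of 2] by blast
  have "(LINT \<theta>|P n. (\<theta> - t n)\<^sup>2) \<le> (C + (1 + T) ^ 5 * K) / n" if n: "N \<le> n" for n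
  proof -
    have n0: "n > 0" using n pos by simp
    have le: "\<bar>(\<theta> - t n)\<^sup>2\<bar> \<le> (1 + T) ^ 5 * (1 + \<bar>\<theta>\<bar>) ^ 5" for \<theta>
    proof -
      have "\<bar>(\<theta> - t n)\<^sup>2\<bar> \<le> (\<bar>\<theta>\<bar> + T)\<^sup>2" using t_le[OF n] by (simp add: abs_le_square_iff[symmetric])
      then show ?thesis using power_le_moment_weight[of 2 T \<theta>] pos by simp
    qed
    have "(LINT \<theta>:-J n|P n. (\<theta> - t n)\<^sup>2) \<le> (1 + T) ^ 5 * (LINT \<theta>:-J n|P n. (1 + \<bar>\<theta>\<bar>) ^ 5)"
      using moment_bound(2)[OF n _ le] by auto
    also have "\<dots> \<le> (1 + T) ^ 5 * (K / n)"
    proof (intro mult_left_mono)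
      have "(LINT \<theta>:-J n|P n. (1 + \<bar>\<theta>\<bar>) ^ 5) \<le> K / real n ^ 4" using tail[OF n] by simp
      also have "\<dots> \<le> K / n"
        using n0 pos by (intro divide_left_mono) (auto simp: self_le_power)
      finally show "(LINT \<theta>:-J n|P n. (1 + \<bar>\<theta>\<bar>) ^ 5) \<le> K / n" .
    qed (use pos in auto)
    moreover have "(LINT \<theta>|P n. (\<theta> - t n)\<^sup>2) = (LINT \<theta>:J n|P n. (\<theta> - t n)\<^sup>2) + (LINT \<theta>:-J n|P n. (\<theta> - t n)\<^sup>2)"
      using integrable_power[OF n, of 2 "t n" 1] by (intro integral_split) simp
    moreover have "(LINT \<theta>:J n|P n. (\<theta> - t n)\<^sup>2) \<le> C / n"
      using C(2)[OF n] by (simp add: power_divide)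
    ultimately show ?thesis by (simp add: add_divide_distrib)
  qed
  then show ?thesis using C(1) pos by (intro that[of "C + (1 + T) ^ 5 * K"]) (auto intro: add_pos_pos)
qed

lemma sd_square: "sd n ^ 2 = (LINT \<theta>|P n. (\<theta> - m n)\<^sup>2)"
  unfolding sd_def std_dev_def m_def by (simp add: integral_nonneg_AE)

lemma sd_nonneg: "0 \<le> sd n"
  unfolding sd_def std_dev_def by (simp add: integral_nonneg_AE)

text \<open>The second moment about \<open>t n\<close> is the sum of the variance and of the squared
  distance between \<open>m n\<close> and \<open>t n\<close>. Both summands are nonnegative, so one
  bound of order 1/n controls both.\<close>

lemma location_scale_upper:
  obtains C where "0 < C" "\<And>n. N \<le> n \<Longrightarrow> sd n \<le> C / sqrt n" "\<And>n. N \<le> n \<Longrightarrow> \<bar>m n - t n\<bar> \<le> C / sqrt n"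
proof -
  obtain C where C: "0 < C" "\<And>n. N \<le> n \<Longrightarrow> (LINT \<theta>|P n. (\<theta> - t n)\<^sup>2) \<le> C / n"
    using second_moment_bound by blast
  have *: "sd n \<le> sqrt C / sqrt n \<and> \<bar>m n - t n\<bar> \<le> sqrt C / sqrt n" if n: "N \<le> n" for n
  proof -
    have "sd n ^ 2 + (m n - t n)\<^sup>2 \<le> C / n"
      using C(2)[OF n] variance_decomposition[OF n, of "t n"] by (simp add: sd_square)
    then have "sd n ^ 2 \<le> C / n" "(m n - t n)\<^sup>2 \<le> C / n"
      using zero_le_power2[of "sd n"] zero_le_power2[of "m n - t n"] by linarith+
    then show ?thesis
      using real_le_rsqrt[of "sd n" "C / n"] real_le_rsqrt[of "\<bar>m n - t n\<bar>" "C / n"]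
      by (simp add: real_sqrt_divide)
  qed
  then show ?thesis using C(1) by (intro that[of "sqrt C"]) auto
qed

text \<open>A Chebyshev argument against the peak height. On \<open>J\<close> the density is at most
  \<open>K * sqrt n / s\<close>, so the part of \<open>J\<close> within distance \<open>r\<close> of
  the mean carries little mass; \<open>J\<close> carries at least 3/4, and what remains lies further
  than \<open>r\<close> from the mean and costs at least r^2 per unit of mass.\<close>

lemma scale_lower:
  obtains c where "0 < c" "\<And>n. N \<le> n \<Longrightarrow> c / sqrt n \<le> sd n"
proof -
  have "s / (16 * K) / sqrt n \<le> sd n" if n: "N \<le> n" for n
  proof -
    interpret prob_space "P n" by (rule prob[OF n])
    have n0: "0 < sqrt n" using n pos by simp
    \<comment> \<open>Chosen so that an interval of length 2r under a density of height
      \<open>K * sqrt n / s\<close> has mass exactly 1/4, which leaves 3/4 - 1/4 = 1/2 for the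
      variance term.\<close>
    define r where "r = s / (8 * K * sqrt n)"
    have r: "0 < r" using pos n0 by (simp add: r_def)
    have bound: "q n \<theta> * indicator (J n) \<theta> \<le> K * sqrt n / s * indicator {m n - r..m n + r} \<theta> + q n \<theta> * ((\<theta> - m n)\<^sup>2 / r\<^sup>2)" for \<theta>
    proof (cases "\<theta> \<in> J n \<and> \<theta> \<in> {m n - r..m n + r}")
      case True
      have "normal_density (t n) (s / sqrt n) \<theta> \<le> exp (- (\<theta> - t n)\<^sup>2 / (2 * (s / sqrt n)\<^sup>2)) / (s / sqrt n)"
        using pos n0 by (intro normal_density_le) simp
      also have "\<dots> \<le> 1 / (s / sqrt n)"
        using pos n0 by (intro divide_right_mono) auto
      finally have "normal_density (t n) (s / sqrt n) \<theta> \<le> sqrt n / s" by simp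
      then have "K * normal_density (t n) (s / sqrt n) \<theta> \<le> K * (sqrt n / s)"
        using pos by (intro mult_left_mono) auto
      then have "q n \<theta> \<le> K * sqrt n / s"
        using q_le[OF n, of \<theta>] True by simp
      then show ?thesis using True q_nonneg[of n \<theta>] by (auto intro: add_increasing2)
    next
      case False
      show ?thesis
      proof (cases "\<theta> \<in> J n")
        case True
        then have "r < \<bar>\<theta> - m n\<bar>" using False by auto
        then have "r\<^sup>2 \<le> (\<theta> - m n)\<^sup>2" using r by (simp add: abs_le_square_iff[symmetric])
        then have "1 \<le> (\<theta> - m n)\<^sup>2 / r\<^sup>2" using r by simp
        from mult_left_mono[OF this q_nonneg[of n \<theta>]] show ?thesis
          using pos n0 True by (auto intro: add_increasing split: split_indicator)
      qed (use pos n0 q_nonneg in auto)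
    qed
    have i: "integrable (P n) (\<lambda>\<theta>. (\<theta> - m n)\<^sup>2 / r\<^sup>2)"
      using integrable_power[OF n, of 2 "m n" r] by (simp add: power_divide)
    have "1 - 1 / 4 \<le> (LINT \<theta>:J n|P n. (1::real))"
    proof -
      have "(LINT \<theta>|P n. (1::real)) = (LINT \<theta>:J n|P n. (1::real)) + (LINT \<theta>:-J n|P n. (1::real))"
        by (rule integral_split) simp
      moreover have "(LINT \<theta>:-J n|P n. (1::real)) \<le> 1 / 4"
        using moment_bound(2)[OF n, of "\<lambda>_. 1" 1] tail[OF n] by force
      ultimately show ?thesis using prob_space by simp
    qed
    also have "(LINT \<theta>:J n|P n. (1::real)) = (LINT \<theta>|lborel. q n \<theta> * indicator (J n) \<theta>)"
      unfolding set_lebesgue_integral_def by (subst integral_P) auto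
    also have "\<dots> \<le> (LINT \<theta>|lborel. K * sqrt n / s * indicator {m n - r..m n + r} \<theta> + q n \<theta> * ((\<theta> - m n)\<^sup>2 / r\<^sup>2))"
    proof (intro integral_mono bound Bochner_Integration.integrable_add)
      have "set_integrable (P n) (J n) (\<lambda>_. 1 :: real)" by (intro set_integrable_cont n continuous_intros)
      then show "integrable lborel (\<lambda>\<theta>. q n \<theta> * indicator (J n) \<theta>)"
        unfolding set_integrable_def by (subst (asm) integrable_P) auto
      show "integrable lborel (\<lambda>\<theta>. q n \<theta> * ((\<theta> - m n)\<^sup>2 / r\<^sup>2))"
        using i by (subst (asm) integrable_P) auto
    qed (intro integrable_mult_right integrable_real_indicator; simp add: emeasure_lborel_Icc_eq)
    also have "\<dots> = K * sqrt n / s * (2 * r) + (LINT \<theta>|P n. (\<theta> - m n)\<^sup>2 / r\<^sup>2)"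
      using i r by (subst Bochner_Integration.integral_add) (auto simp: integral_P integrable_P)
    also have "\<dots> = 1 / 4 + sd n ^ 2 / r\<^sup>2"
      using pos n0 by (simp add: r_def sd_square)
    finally have "1 / 2 \<le> sd n ^ 2 / r\<^sup>2" by linarith
    \<comment> \<open>The factor 1/2 is weakened to 1/4 to obtain a perfect square.\<close>
    then have "r\<^sup>2 / 4 \<le> sd n ^ 2" using r by (simp add: pos_le_divide_eq zero_le_power2[of "sd n"] algebra_simps) (use zero_le_power2[of "sd n"] in linarith)
    then have "(r / 2)\<^sup>2 \<le> sd n ^ 2" by (simp add: power_divide)
    then have "r / 2 \<le> sd n" using sd_nonneg by (rule power2_le_imp_le)
    then show ?thesis by (simp add: r_def field_simps)
  qed
  then show ?thesis using pos by (intro that[of "s / (16 * K)"]) auto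
qed

end

lemma power_sum_le:
  fixes a b :: real
  assumes "0 \<le> a" "0 \<le> b" shows "(a + b) ^ k \<le> 2 ^ k * (a ^ k + b ^ k)"
proof -
  have "(a + b) ^ k \<le> (2 * max a b) ^ k" using assms by (intro power_mono) auto
  also have "\<dots> = 2 ^ k * max a b ^ k" by (simp add: power_mult_distrib)
  also have "\<dots> \<le> 2 ^ k * (a ^ k + b ^ k)" using assms by (intro mult_left_mono) (auto simp: max_def)
  finally show ?thesis .
qed

section \<open>Moments of the standardized variable on and off the interval\<close>

context concentrating_densities
begin

definition w :: "nat \<Rightarrow> real \<Rightarrow> real" where
  "w n \<theta> = (\<theta> - m n) / sd n"

definition \<nu> :: "nat \<Rightarrow> nat \<Rightarrow> real" where
  "\<nu> k n = (LINT \<theta>:J n|P n. w n \<theta> ^ k)"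

lemma sd_pos: "N \<le> n \<Longrightarrow> 0 < sd n"
  using scale_lower pos by (metis divide_pos_pos le_trans less_le_trans not_le of_nat_0_less_iff real_sqrt_gt_zero)

lemma w_cont [continuous_intros]: "continuous_on A (w n)"
  unfolding w_def divide_inverse by (intro continuous_intros)

lemma w_meas [measurable]: "w n \<in> borel_measurable borel"
  by (intro borel_measurable_continuous_onI w_cont)

text \<open>The domination is centred at \<open>t n\<close> but \<open>w\<close> at
  \<open>m n\<close>. The shift is at most of order n^(-1/2), as is the typical size of
  \<open>\<theta> - t n\<close>, and dividing by \<open>sd n\<close>, which is at least
  \<open>c / sqrt n\<close>, cancels all powers of n.\<close>

lemma local_w_moment:
  obtains C where "0 < C" "\<And>n. N \<le> n \<Longrightarrow> (LINT \<theta>:J n|P n. \<bar>w n \<theta>\<bar> ^ k) \<le> C"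
proof -
  obtain C where C: "0 < C" "\<And>n. N \<le> n \<Longrightarrow> (LINT \<theta>:J n|P n. \<bar>\<theta> - t n\<bar> ^ k) \<le> C * (1 / sqrt n) ^ k"
    using local_moment[of k] by blast
  obtain A where A: "0 < A" "\<And>n. N \<le> n \<Longrightarrow> \<bar>m n - t n\<bar> \<le> A / sqrt n"
    using location_scale_upper by metis
  obtain c where c: "0 < c" "\<And>n. N \<le> n \<Longrightarrow> c / sqrt n \<le> sd n"
    using scale_lower by metis
  have "(LINT \<theta>:J n|P n. \<bar>w n \<theta>\<bar> ^ k) \<le> 2 ^ k * (C + A ^ k) / c ^ k" if n: "N \<le> n" for n
  proof -
    interpret prob_space "P n" by (rule prob[OF n])
    have n0: "0 < sqrt n" using n pos by simp
    have const: "(LINT \<theta>:J n|P n. b) \<le> b" if "0 \<le> b" for b :: real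
      using that prob_le_1[of "J n"] by (simp add: set_lebesgue_integral_def mult_left_le_one_le)
    have le: "\<bar>w n \<theta>\<bar> ^ k \<le> (2 ^ k / sd n ^ k) * (\<bar>\<theta> - t n\<bar> ^ k + (A / sqrt n) ^ k)" for \<theta>
    proof -
      have "\<bar>\<theta> - m n\<bar> ^ k \<le> (\<bar>\<theta> - t n\<bar> + A / sqrt n) ^ k"
        using A(2)[OF n] by (intro power_mono) auto
      also have "\<dots> \<le> 2 ^ k * (\<bar>\<theta> - t n\<bar> ^ k + (A / sqrt n) ^ k)"
        using A(1) n0 by (intro power_sum_le) auto
      finally show ?thesis
        using sd_pos[OF n] by (simp add: w_def power_divide divide_right_mono)
    qed
    have "(LINT \<theta>:J n|P n. \<bar>w n \<theta>\<bar> ^ k) \<le> (LINT \<theta>:J n|P n. (2 ^ k / sd n ^ k) * (\<bar>\<theta> - t n\<bar> ^ k + (A / sqrt n) ^ k))"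
      by (intro set_integral_mono set_integrable_cont n continuous_intros le)
    also have "\<dots> = (2 ^ k / sd n ^ k) * (LINT \<theta>:J n|P n. \<bar>\<theta> - t n\<bar> ^ k + (A / sqrt n) ^ k)"
      by (rule set_integral_mult_right)
    also have "(LINT \<theta>:J n|P n. \<bar>\<theta> - t n\<bar> ^ k + (A / sqrt n) ^ k) =
        (LINT \<theta>:J n|P n. \<bar>\<theta> - t n\<bar> ^ k) + (LINT \<theta>:J n|P n. (A / sqrt n) ^ k)"
      by (intro set_integral_add set_integrable_cont n continuous_intros)
    also have "(2 ^ k / sd n ^ k) * \<dots> \<le> (2 ^ k / (c / sqrt n) ^ k) * (C * (1 / sqrt n) ^ k + (A / sqrt n) ^ k)"
      using c A(1) n0 sd_pos[OF n] C(2)[OF n] const[of "(A / sqrt n) ^ k"]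
      by (intro mult_mono add_mono divide_left_mono power_mono c n)
        (auto intro!: add_nonneg_nonneg Bochner_Integration.integral_nonneg simp: set_lebesgue_integral_def)
    also have "\<dots> = 2 ^ k * (C + A ^ k) / c ^ k"
      using n0 c by (simp add: power_divide field_simps)
    finally show ?thesis .
  qed
  moreover have "0 < 2 ^ k * (C + A ^ k) / c ^ k" using C(1) A(1) c(1) by (simp add: add_pos_pos)
  ultimately show ?thesis using that by blast
qed

text \<open>Dividing by \<open>sd n ^ k\<close> costs at most a factor of order n^(5/2). Against a
  tail of order n^(-4) this leaves n^(-3/2), which explains the fourth power in the locale
  assumption \<open>tail\<close>.\<close>

lemma w_tail_moment:
  assumes k: "k \<le> 5"
  obtains C where "\<And>n. N \<le> n \<Longrightarrow> \<bar>LINT \<theta>:-J n|P n. w n \<theta> ^ k\<bar> \<le> C * (1 / sqrt n) ^ 3"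
proof -
  obtain A where A: "0 < A" "\<And>n. N \<le> n \<Longrightarrow> \<bar>m n - t n\<bar> \<le> A / sqrt n"
    using location_scale_upper by metis
  obtain c where c: "0 < c" "\<And>n. N \<le> n \<Longrightarrow> c / sqrt n \<le> sd n"
    using scale_lower by metis
  have "\<bar>LINT \<theta>:-J n|P n. w n \<theta> ^ k\<bar> \<le> ((1 + (T + A)) ^ 5 / c ^ k * K) * (1 / sqrt n) ^ 3" if n: "N \<le> n" for n
  proof -
    have n0: "1 \<le> sqrt n" using n pos by simp
    have "A / sqrt n \<le> A" using n0 A(1) by (simp add: divide_le_eq)
    then have m: "\<bar>m n\<bar> \<le> T + A" using A(2)[OF n] t_le[OF n] by linarith
    have sd: "1 / sd n ^ k \<le> sqrt n ^ 5 / c ^ k"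
    proof -
      have "1 / sd n ^ k \<le> 1 / (c / sqrt n) ^ k"
        using c n0 sd_pos[OF n] n by (intro divide_left_mono power_mono) auto
      also have "\<dots> = sqrt n ^ k / c ^ k" by (simp add: power_divide)
      also have "\<dots> \<le> sqrt n ^ 5 / c ^ k"
        using c n0 k by (intro divide_right_mono power_increasing) auto
      finally show ?thesis .
    qed
    have le: "\<bar>w n \<theta> ^ k\<bar> \<le> (sqrt n ^ 5 / c ^ k * (1 + (T + A)) ^ 5) * (1 + \<bar>\<theta>\<bar>) ^ 5" for \<theta>
    proof -
      have "\<bar>\<theta> - m n\<bar> ^ k \<le> (\<bar>\<theta>\<bar> + (T + A)) ^ k" using m by (intro power_mono) auto
      also have "\<dots> \<le> (1 + (T + A)) ^ 5 * (1 + \<bar>\<theta>\<bar>) ^ 5"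
        using A(1) pos by (intro power_le_moment_weight[OF k]) auto
      finally have "1 / sd n ^ k * \<bar>\<theta> - m n\<bar> ^ k \<le> sqrt n ^ 5 / c ^ k * ((1 + (T + A)) ^ 5 * (1 + \<bar>\<theta>\<bar>) ^ 5)"
        using sd c(1) by (intro mult_mono) auto
      then show ?thesis using sd_pos[OF n] by (simp add: w_def power_divide power_abs mult.assoc)
    qed
    have "\<bar>LINT \<theta>:-J n|P n. w n \<theta> ^ k\<bar> \<le> (sqrt n ^ 5 / c ^ k * (1 + (T + A)) ^ 5) * (LINT \<theta>:-J n|P n. (1 + \<bar>\<theta>\<bar>) ^ 5)"
      by (rule moment_bound(2)[OF n _ le]) simp
    also have "\<dots> \<le> (sqrt n ^ 5 / c ^ k * (1 + (T + A)) ^ 5) * (K / real n ^ 4)"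
      using tail[OF n] c A(1) pos by (intro mult_left_mono) auto
    also have "real n ^ 4 = sqrt n ^ 5 * sqrt n ^ 3"
    proof -
      have "real n ^ 4 = (sqrt n ^ 2) ^ 4" by simp
      also have "\<dots> = sqrt n ^ 5 * sqrt n ^ 3" by (simp only: power_mult[symmetric] power_add[symmetric]) simp
      finally show ?thesis .
    qed
    also have "(sqrt n ^ 5 / c ^ k * (1 + (T + A)) ^ 5) * (K / (sqrt n ^ 5 * sqrt n ^ 3)) =
        ((1 + (T + A)) ^ 5 / c ^ k * K) * (1 / sqrt n) ^ 3"
    proof -
      have "y / a * b * (K / (y * z)) = b / a * K * (1 / z)" if "0 < y" for a b y z :: real
        using that by simp
      then show ?thesis using n0 unfolding power_one_over by (metis less_le_trans zero_less_one zero_less_power)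
    qed
    finally show ?thesis .
  qed
  then show ?thesis using that by blast
qed

lemma w_moments:
  assumes n: "N \<le> n"
  shows "(LINT \<theta>|P n. w n \<theta> ^ 0) = 1" "(LINT \<theta>|P n. w n \<theta> ^ 1) = 0" "(LINT \<theta>|P n. w n \<theta> ^ 2) = 1"
proof -
  interpret prob_space "P n" by (rule prob[OF n])
  show "(LINT \<theta>|P n. w n \<theta> ^ 0) = 1" using prob_space by simp
  have i1: "integrable (P n) (\<lambda>\<theta>. \<theta>)"
    using integrable_power[OF n, of 1 0 1] by simp
  have "(LINT \<theta>|P n. w n \<theta> ^ 1) = ((LINT \<theta>|P n. \<theta>) - m n) / sd n"
    using i1 prob_space by (simp add: w_def)
  then show "(LINT \<theta>|P n. w n \<theta> ^ 1) = 0" by (simp add: m_def mean_def)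
  have "(LINT \<theta>|P n. w n \<theta> ^ 2) = (LINT \<theta>|P n. (\<theta> - m n)\<^sup>2) / sd n ^ 2"
    by (simp add: w_def power_divide)
  then show "(LINT \<theta>|P n. w n \<theta> ^ 2) = 1" using sd_pos[OF n] by (simp flip: sd_square)
qed

lemma truncation_error:
  assumes k: "k \<le> 5"
  shows "(\<lambda>n. \<nu> k n - (LINT \<theta>|P n. w n \<theta> ^ k)) \<in> O(\<lambda>n. (1 / sqrt n) ^ 3)"
proof -
  obtain C where C: "\<And>n. N \<le> n \<Longrightarrow> \<bar>LINT \<theta>:-J n|P n. w n \<theta> ^ k\<bar> \<le> C * (1 / sqrt n) ^ 3"
    using w_tail_moment[OF k] by blast
  show ?thesis
  proof (rule bigoI[of _ C], rule eventually_sequentiallyI[of N])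
    fix n assume n: "N \<le> n"
    have "integrable (P n) (\<lambda>\<theta>. w n \<theta> ^ k)"
      unfolding w_def by (rule integrable_power[OF n k])
    then have "\<nu> k n - (LINT \<theta>|P n. w n \<theta> ^ k) = - (LINT \<theta>:-J n|P n. w n \<theta> ^ k)"
      using integral_split[of n "\<lambda>\<theta>. w n \<theta> ^ k"] by (simp add: \<nu>_def)
    then show "norm (\<nu> k n - (LINT \<theta>|P n. w n \<theta> ^ k)) \<le> C * norm ((1 / sqrt n) ^ 3)"
      using C[OF n] by simp
  qed
qed

section \<open>Integration by parts and the relations between local moments\<close>

text \<open>The integrand times \<open>q n\<close> is the derivative of
  \<open>w n \<theta> ^ k * q n \<theta>\<close>. Since \<open>J\<close> is bounded, the values at
  its end points remain and have to be estimated separately.\<close>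

lemma stein_identity:
  assumes n: "N \<le> n"
  shows "(LINT \<theta>:J n|P n. D n 0 \<theta> * w n \<theta> ^ k + real k / sd n * w n \<theta> ^ (k - 1)) =
    w n (t n + \<rho>) ^ k * q n (t n + \<rho>) - w n (t n - \<rho>) ^ k * q n (t n - \<rho>)"
proof -
  let ?g = "\<lambda>\<theta>. D n 0 \<theta> * w n \<theta> ^ k + real k / sd n * w n \<theta> ^ (k - 1)"
  have sd: "sd n \<noteq> 0" using sd_pos[OF n] by simp
  have w_deriv: "(w n has_real_derivative 1 / sd n) (at \<theta>)" for \<theta>
    unfolding w_def using sd by (auto intro!: derivative_eq_intros)
  have cD: "isCont (D n 0) \<theta>" if "\<theta> \<in> J n" for \<theta>
    using D_deriv[OF n that, of 0] by (auto intro: DERIV_isCont)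
  have cw: "isCont (w n) \<theta>" for \<theta> using w_deriv by (auto intro: DERIV_isCont)
  have "continuous_on (J n) ?g"
    by (intro continuous_intros) (auto intro: continuous_at_imp_continuous_on cD)
  then have "(\<lambda>\<theta>. indicator (J n) \<theta> *\<^sub>R ?g \<theta>) \<in> borel_measurable borel"
    by (intro borel_measurable_continuous_on_indicator) auto
  then have "(LINT \<theta>:J n|P n. ?g \<theta>) = (LINT \<theta>|lborel. q n \<theta> * (indicator (J n) \<theta> *\<^sub>R ?g \<theta>))"
    unfolding set_lebesgue_integral_def by (rule integral_P)
  also have "\<dots> = (LINT \<theta>|lborel. (?g \<theta> * q n \<theta>) * indicator {t n - \<rho>..t n + \<rho>} \<theta>)"
    by (intro Bochner_Integration.integral_cong) (auto simp: J_def)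
  also have "\<dots> = w n (t n + \<rho>) ^ k * q n (t n + \<rho>) - w n (t n - \<rho>) ^ k * q n (t n - \<rho>)"
  proof (rule integral_FTC_Icc_real)
    fix \<theta> assume "t n - \<rho> \<le> \<theta>" "\<theta> \<le> t n + \<rho>"
    then have \<theta>: "\<theta> \<in> J n" by (simp add: J_def)
    show "((\<lambda>\<theta>. w n \<theta> ^ k * q n \<theta>) has_real_derivative ?g \<theta> * q n \<theta>) (at \<theta>)"
      by (rule derivative_eq_intros q_deriv[OF n \<theta>] w_deriv refl)+ (simp add: algebra_simps)
    have "isCont (q n) \<theta>" using q_deriv[OF n \<theta>] by (rule DERIV_isCont)
    then show "isCont (\<lambda>\<theta>. ?g \<theta> * q n \<theta>) \<theta>"
      by (intro continuous_intros cD[OF \<theta>] cw) auto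
  qed (use pos in simp)
  finally show ?thesis .
qed

text \<open>Degree 3 is where the expansion may stop: after multiplication by \<open>sd n\<close>
  the remainder is of order n * sd^5 * |w|^4, that is n^(-3/2).\<close>

lemma D_expansion:
  assumes n: "N \<le> n" and a: "a \<in> J n" and \<theta>: "\<theta> \<in> J n"
  shows "\<bar>D n 0 \<theta> - (\<Sum>j<4. D n j a / fact j * (\<theta> - a) ^ j)\<bar> \<le> B * n / 24 * \<bar>\<theta> - a\<bar> ^ 4"
proof (cases "\<theta> = a")
  case True
  then show ?thesis by (simp add: eval_nat_numeral)
next
  case False
  have "\<exists>u. (if \<theta> < a then \<theta> < u \<and> u < a else a < u \<and> u < \<theta>) \<and>
    D n 0 \<theta> = (\<Sum>j<4. D n j a / fact j * (\<theta> - a) ^ j) + D n 4 u / fact 4 * (\<theta> - a) ^ 4"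
    by (rule Taylor[of 4 "D n" "D n 0" "t n - \<rho>" "t n + \<rho>"])
      (use a \<theta> False in \<open>auto simp: J_def intro!: D_deriv[OF n]\<close>)
  then obtain u where u: "if \<theta> < a then \<theta> < u \<and> u < a else a < u \<and> u < \<theta>"
    "D n 0 \<theta> = (\<Sum>j<4. D n j a / fact j * (\<theta> - a) ^ j) + D n 4 u / fact 4 * (\<theta> - a) ^ 4" by blast
  have "u \<in> J n" using u(1) a \<theta> by (auto simp: J_def split: if_splits)
  then have "\<bar>D n 4 u\<bar> / 24 * \<bar>\<theta> - a\<bar> ^ 4 \<le> B * n / 24 * \<bar>\<theta> - a\<bar> ^ 4"
    using D_le[OF n, of u 4] by (intro mult_right_mono divide_right_mono) auto
  then show ?thesis using u(2) by (simp add: abs_mult power_abs fact_numeral)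
qed

text \<open>Derivatives of the log density are controlled on \<open>J\<close> only, so the expansion
  point must lie there.\<close>

lemma eventually_mean_in_J: "eventually (\<lambda>n. m n \<in> J n) sequentially"
proof -
  obtain A where A: "0 < A" "\<And>n. N \<le> n \<Longrightarrow> \<bar>m n - t n\<bar> \<le> A / sqrt n"
    using location_scale_upper by metis
  have "eventually (\<lambda>n. A / sqrt (real n) < \<rho>) sequentially"
    using pos A by real_asymp
  then show ?thesis using eventually_ge_at_top[of N]
  proof eventually_elim
    case (elim n)
    then show ?case using A(2)[of n] by (auto simp: J_def)
  qed
qed

text \<open>The coefficients of \<open>sd n * D n 0 \<theta>\<close> as a polynomial in
  \<open>w n \<theta>\<close>. The extra factor \<open>sd n\<close> turns \<open>k / sd n\<close> in
  the integration by parts into \<open>k\<close>.\<close>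

definition a :: "nat \<Rightarrow> nat \<Rightarrow> real" where
  "a j n = sd n ^ (j + 1) * D n j (m n) / fact j"

text \<open>At \<open>t n\<close> the derivative of the log density is bounded. On the way to the
  mean, at distance of order n^(-1/2), it changes by at most order n * n^(-1/2), and multiplication
  by \<open>sd n\<close> gives O(1). The higher coefficients are sd^(j+2) times a derivative of
  order n, that is n^(-j/2).\<close>

lemma a_bigo: "a 0 \<in> O(\<lambda>_. 1)" "a (Suc j) \<in> O(\<lambda>n. (1 / sqrt n) ^ j)" if "j < 4"
proof -
  obtain A where A: "0 < A" "\<And>n. N \<le> n \<Longrightarrow> sd n \<le> A / sqrt n" "\<And>n. N \<le> n \<Longrightarrow> \<bar>m n - t n\<bar> \<le> A / sqrt n"
    using location_scale_upper by metis
  show "a 0 \<in> O(\<lambda>_. 1)"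
  proof (rule bigoI[of _ "A * (B + B * A)"])
    show "eventually (\<lambda>n. norm (a 0 n) \<le> A * (B + B * A) * norm (1 :: real)) sequentially"
      using eventually_mean_in_J eventually_ge_at_top[of N]
    proof eventually_elim
      case (elim n)
      have n0: "1 \<le> sqrt n" using elim pos by simp
      have "\<bar>D n 0 (m n) - D n 0 (t n)\<bar> \<le> B * n * \<bar>m n - t n\<bar>"
      proof -
        have "norm (D n 0 (m n) - D n 0 (t n)) \<le> B * n * norm (m n - t n)"
        proof (rule field_differentiable_bound[of "J n" _ "D n 1"])
          show "convex (J n)" by (simp add: J_def)
          show "(D n 0 has_field_derivative D n 1 z) (at z within J n)" if "z \<in> J n" for z
            using D_deriv[OF elim(2) that, of 0] by (auto intro: has_field_derivative_at_within)
          show "norm (D n 1 z) \<le> B * n" if "z \<in> J n" for z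
            using D_le[OF elim(2) that, of 1] by simp
        qed (use elim t_in_J in auto)
        then show ?thesis by simp
      qed
      also have "\<dots> \<le> B * n * (A / sqrt n)" using A(3)[OF elim(2)] pos by (intro mult_left_mono) auto
      also have "\<dots> = B * A * (n / sqrt n)" by simp
      also have "\<dots> = B * A * sqrt n" by (simp only: real_div_sqrt of_nat_0_le_iff)
      finally have "\<bar>D n 0 (m n)\<bar> \<le> B + B * A * sqrt n" using D_centre[OF elim(2)] by linarith
      also have "\<dots> \<le> (B + B * A) * sqrt n" using n0 pos by (simp add: algebra_simps)
      finally have "sd n * \<bar>D n 0 (m n)\<bar> \<le> (A / sqrt n) * ((B + B * A) * sqrt n)"
        using A(1,2) elim n0 sd_nonneg by (intro mult_mono) auto
      also have "\<dots> = A * (B + B * A)" using n0 by simp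
      finally show ?case using sd_nonneg[of n] by (simp add: a_def abs_mult)
    qed
  qed
  show "a (Suc j) \<in> O(\<lambda>n. (1 / sqrt n) ^ j)"
  proof (rule bigoI[of _ "A ^ (j + 2) * B"])
    show "eventually (\<lambda>n. norm (a (Suc j) n) \<le> A ^ (j + 2) * B * norm ((1 / sqrt n) ^ j)) sequentially"
      using eventually_mean_in_J eventually_ge_at_top[of N]
    proof eventually_elim
      case (elim n)
      have n0: "0 < sqrt n" using elim pos by simp
      have "\<bar>D n (Suc j) (m n)\<bar> / fact (Suc j) \<le> B * n / 1"
        using D_le[OF elim(2,1), of "Suc j"] that pos by (intro frac_le) (auto simp del: fact_Suc)
      then have "sd n ^ (j + 2) * (\<bar>D n (Suc j) (m n)\<bar> / fact (Suc j)) \<le> (A / sqrt n) ^ (j + 2) * (B * n)"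
        using A(1,2) elim sd_nonneg n0 by (intro mult_mono power_mono) auto
      also have "\<dots> = A ^ (j + 2) * B * (1 / sqrt n) ^ j"
      proof -
        have "(A / x) ^ (j + 2) * (B * (x * x)) = A ^ (j + 2) * B * (1 / x) ^ j" if "0 < x" for x
          using that by (simp add: power_divide power_add power2_eq_square)
        from this[OF n0] show ?thesis by simp
      qed
      finally show ?case using sd_nonneg[of n] by (simp add: a_def abs_mult del: fact_Suc)
    qed
  qed
qed

text \<open>The end points of \<open>J\<close> keep the fixed distance \<open>\<rho>\<close> from
  \<open>t n\<close>, so the dominating normal density there is at most sqrt n / s times
  \<open>exp (- \<gamma> * n)\<close>, while powers of \<open>w\<close> grow only polynomially in
  n.\<close>

lemma boundary_bigo:
  "(\<lambda>n. sd n * (w n (t n + \<rho>) ^ k * q n (t n + \<rho>) - w n (t n - \<rho>) ^ k * q n (t n - \<rho>)))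
     \<in> O(\<lambda>n. (1 / sqrt n) ^ 3)"
proof -
  obtain A where A: "0 < A" "\<And>n. N \<le> n \<Longrightarrow> sd n \<le> A / sqrt n" "\<And>n. N \<le> n \<Longrightarrow> \<bar>m n - t n\<bar> \<le> A / sqrt n"
    using location_scale_upper by metis
  obtain c where c: "0 < c" "\<And>n. N \<le> n \<Longrightarrow> c / sqrt n \<le> sd n"
    using scale_lower by metis
  define \<gamma> where "\<gamma> = \<rho>\<^sup>2 / (2 * s\<^sup>2)"
  have \<gamma>: "0 < \<gamma>" using pos by (simp add: \<gamma>_def)
  define h where "h n = A * ((\<rho> + A) / c * sqrt n) ^ k * (K * (exp (- \<gamma> * n) * sqrt n / s))" for n :: nat
  have one: "\<bar>sd n * (w n \<theta> ^ k * q n \<theta>)\<bar> \<le> h n" if n: "N \<le> n" and \<theta>: "\<theta> = t n + \<rho> \<or> \<theta> = t n - \<rho>" for n \<theta>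
  proof -
    have n0: "1 \<le> sqrt n" using n pos by simp
    have An: "A / sqrt n \<le> A" using n0 A(1) by (simp add: divide_le_eq)
    have sd: "sd n \<le> A" using An A(2)[OF n] by simp
    have "\<bar>\<theta> - m n\<bar> \<le> \<rho> + A" using \<theta> An A(3)[OF n] pos by linarith
    then have "\<bar>w n \<theta>\<bar> \<le> (\<rho> + A) / (c / sqrt n)"
      using c n0 sd_pos[OF n] n A(1) pos unfolding w_def abs_divide by (intro frac_le) auto
    then have w: "\<bar>w n \<theta>\<bar> \<le> (\<rho> + A) / c * sqrt n" by simp
    have "\<theta> \<in> J n" using \<theta> pos by (auto simp: J_def)
    then have "q n \<theta> \<le> K * normal_density (t n) (s / sqrt n) \<theta>" by (rule q_le[OF n])
    also have "\<dots> \<le> K * (exp (- (\<theta> - t n)\<^sup>2 / (2 * (s / sqrt n)\<^sup>2)) / (s / sqrt n))"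
      using pos n0 by (intro mult_left_mono normal_density_le) auto
    also have "\<dots> = K * (exp (- \<gamma> * n) * sqrt n / s)"
      using \<theta> n0 by (auto simp: \<gamma>_def power_divide)
    finally have q: "q n \<theta> \<le> K * (exp (- \<gamma> * n) * sqrt n / s)" .
    have "\<bar>sd n * (w n \<theta> ^ k * q n \<theta>)\<bar> = sd n * (\<bar>w n \<theta>\<bar> ^ k * q n \<theta>)"
      using sd_nonneg[of n] q_nonneg[of n \<theta>] by (simp add: abs_mult power_abs)
    also have "\<dots> \<le> A * (((\<rho> + A) / c * sqrt n) ^ k * (K * (exp (- \<gamma> * n) * sqrt n / s)))"
      using sd w q A(1) sd_nonneg[of n] q_nonneg[of n \<theta>] c pos by (intro mult_mono power_mono) auto
    finally show ?thesis by (simp add: h_def mult.assoc)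
  qed
  have "(\<lambda>n. sd n * (w n (t n + \<rho>) ^ k * q n (t n + \<rho>) - w n (t n - \<rho>) ^ k * q n (t n - \<rho>))) \<in> O(\<lambda>n. h n)"
  proof (rule bigoI[of _ 2], rule eventually_sequentiallyI[of N])
    fix n assume n: "N \<le> n"
    show "norm (sd n * (w n (t n + \<rho>) ^ k * q n (t n + \<rho>) - w n (t n - \<rho>) ^ k * q n (t n - \<rho>))) \<le> 2 * norm (h n)"
      using one[OF n, of "t n + \<rho>"] one[OF n, of "t n - \<rho>"] by (simp add: right_diff_distrib)
  qed
  also have "h \<in> O(\<lambda>n. (1 / sqrt n) ^ 3)"
  proof -
    have "(\<lambda>n::nat. sqrt (real n) ^ k * (exp (- \<gamma> * n) * sqrt n)) \<in> O(\<lambda>n. (1 / sqrt n) ^ 3)"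
      using \<gamma> by real_asymp
    then have "(\<lambda>n::nat. (A * ((\<rho> + A) / c) ^ k * K / s) * (sqrt (real n) ^ k * (exp (- \<gamma> * n) * sqrt n))) \<in> O(\<lambda>n. (1 / sqrt n) ^ 3)"
      using A(1) c(1) pos by (subst landau_o.big.cmult_in_iff) auto
    then show ?thesis by (simp add: h_def[abs_def] power_mult_distrib power_divide mult_ac)
  qed
  finally show ?thesis .
qed

text \<open>This is \<open>sd n\<close> times the integration by parts identity with the cubic
  Taylor polynomial at the mean in place of the derivative of the log density. The left-hand side
  equals boundary terms minus Taylor remainder exactly, from \<open>N\<close> on.\<close>

lemma recurrence:
  "(\<lambda>n. a 0 n * \<nu> k n + a 1 n * \<nu> (k+1) n + a 2 n * \<nu> (k+2) n + a 3 n * \<nu> (k+3) n + real k * \<nu> (k - 1) n)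
     \<in> O(\<lambda>n. (1 / sqrt n) ^ 3)"
proof -
  define b where "b n = sd n * (w n (t n + \<rho>) ^ k * q n (t n + \<rho>) - w n (t n - \<rho>) ^ k * q n (t n - \<rho>))" for n
  define R where "R n = (LINT \<theta>:J n|P n. sd n * (D n 0 \<theta> - (\<Sum>j<4. D n j (m n) / fact j * (\<theta> - m n) ^ j)) * w n \<theta> ^ k)" for n
  obtain C where C: "0 < C" "\<And>n. N \<le> n \<Longrightarrow> (LINT \<theta>:J n|P n. \<bar>w n \<theta>\<bar> ^ (k + 4)) \<le> C"
    using local_w_moment by metis
  obtain A where A: "0 < A" "\<And>n. N \<le> n \<Longrightarrow> sd n \<le> A / sqrt n"
    using location_scale_upper by metis
  have cD: "continuous_on (J n) (D n 0)" if n: "N \<le> n" for n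
    using D_deriv[OF n, of _ 0] by (auto intro!: continuous_at_imp_continuous_on DERIV_isCont)
  have R: "R \<in> O(\<lambda>n. (1 / sqrt n) ^ 3)"
  proof (rule bigoI[of _ "A ^ 5 * B / 24 * C"])
    show "eventually (\<lambda>n. norm (R n) \<le> A ^ 5 * B / 24 * C * norm ((1 / sqrt n) ^ 3)) sequentially"
      using eventually_mean_in_J eventually_ge_at_top[of N]
    proof eventually_elim
      case (elim n)
      note n = elim(2)
      let ?r = "\<lambda>\<theta>. sd n * (D n 0 \<theta> - (\<Sum>j<4. D n j (m n) / fact j * (\<theta> - m n) ^ j)) * w n \<theta> ^ k"
      have n0: "0 < sqrt n" using n pos by simp
      \<comment> \<open>Four factors \<open>\<theta> - m n\<close> from the remainder become four
        factors \<open>sd n * w\<close>, and the fifth \<open>sd n\<close> is the common multiplier;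
        hence the local moment of order k + 4.\<close>
      have le: "\<bar>?r \<theta>\<bar> \<le> sd n ^ 5 * (B * n / 24) * \<bar>w n \<theta>\<bar> ^ (k + 4)" if "\<theta> \<in> J n" for \<theta>
      proof -
        have eq: "\<bar>\<theta> - m n\<bar> = sd n * \<bar>w n \<theta>\<bar>" using sd_pos[OF n] by (simp add: w_def)
        have "\<bar>?r \<theta>\<bar> = sd n * \<bar>D n 0 \<theta> - (\<Sum>j<4. D n j (m n) / fact j * (\<theta> - m n) ^ j)\<bar> * \<bar>w n \<theta>\<bar> ^ k"
          using sd_nonneg[of n] by (simp add: abs_mult power_abs)
        also have "\<dots> \<le> sd n * (B * n / 24 * (sd n * \<bar>w n \<theta>\<bar>) ^ 4) * \<bar>w n \<theta>\<bar> ^ k"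
          using D_expansion[OF n elim(1) that] sd_nonneg[of n] unfolding eq
          by (intro mult_right_mono mult_left_mono) auto
        also have "\<dots> = sd n ^ 5 * (B * n / 24) * \<bar>w n \<theta>\<bar> ^ (k + 4)"
          by (simp add: power_mult_distrib power_add eval_nat_numeral)
        finally show ?thesis .
      qed
      have ir: "set_integrable (P n) (J n) ?r"
        by (intro set_integrable_cont n continuous_intros cD)
      have "\<bar>R n\<bar> \<le> (LINT \<theta>:J n|P n. \<bar>?r \<theta>\<bar>)"
        unfolding set_lebesgue_integral_def R_def
        by (rule order_trans[OF integral_abs_bound]) (auto simp: abs_mult)
      also have "\<dots> \<le> (LINT \<theta>:J n|P n. sd n ^ 5 * (B * n / 24) * \<bar>w n \<theta>\<bar> ^ (k + 4))"
        by (intro set_integral_mono set_integrable_cont n continuous_intros cD le)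
      also have "\<dots> = sd n ^ 5 * (B * n / 24) * (LINT \<theta>:J n|P n. \<bar>w n \<theta>\<bar> ^ (k + 4))"
        by (rule set_integral_mult_right)
      also have "\<dots> \<le> (A / sqrt n) ^ 5 * (B * n / 24) * C"
        using A n C sd_nonneg pos n0
        by (intro mult_mono power_mono) (auto intro!: Bochner_Integration.integral_nonneg simp: set_lebesgue_integral_def)
      also have "\<dots> = A ^ 5 * B / 24 * C * (1 / sqrt n) ^ 3"
        using n0 by (simp add: power_divide eval_nat_numeral field_simps)
      finally show ?case by simp
    qed
  qed
  have b: "b \<in> O(\<lambda>n. (1 / sqrt n) ^ 3)" unfolding b_def by (rule boundary_bigo)
  have "eventually (\<lambda>n. a 0 n * \<nu> k n + a 1 n * \<nu> (k+1) n + a 2 n * \<nu> (k+2) n + a 3 n * \<nu> (k+3) n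
      + real k * \<nu> (k - 1) n = b n - R n) sequentially"
  proof (rule eventually_sequentiallyI[of N])
    fix n assume n: "N \<le> n"
    have sd: "sd n > 0" by (rule sd_pos[OF n])
    have eq: "sd n * (D n j (m n) / fact j * (\<theta> - m n) ^ j) = a j n * w n \<theta> ^ j" for j \<theta>
      using sd by (simp add: a_def w_def power_divide)
    have "b n - R n =
      (LINT \<theta>:J n|P n. sd n * (D n 0 \<theta> * w n \<theta> ^ k + real k / sd n * w n \<theta> ^ (k - 1)) -
         sd n * (D n 0 \<theta> - (\<Sum>j<4. D n j (m n) / fact j * (\<theta> - m n) ^ j)) * w n \<theta> ^ k)"
      unfolding b_def stein_identity[OF n, symmetric] R_def set_integral_mult_right[symmetric]
      by (rule set_integral_diff(2)[symmetric]; intro set_integrable_cont n continuous_intros cD)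
    also have "\<dots> = (LINT \<theta>:J n|P n. a 0 n * w n \<theta> ^ k + a 1 n * w n \<theta> ^ (k+1) + a 2 n * w n \<theta> ^ (k+2)
        + a 3 n * w n \<theta> ^ (k+3) + real k * w n \<theta> ^ (k - 1))"
    proof (intro set_lebesgue_integral_cong allI impI)
      fix \<theta>
      have S: "sd n * (\<Sum>j<4. D n j (m n) / fact j * (\<theta> - m n) ^ j) =
          a 0 n + a 1 n * w n \<theta> + a 2 n * w n \<theta> ^ 2 + a 3 n * w n \<theta> ^ 3"
      proof -
        have "{..<4} = {0, 1, 2, 3 :: nat}" by auto
        then show ?thesis unfolding sum_distrib_left eq by simp
      qed
      have "sd n * (D n 0 \<theta> * w n \<theta> ^ k + real k / sd n * w n \<theta> ^ (k - 1)) -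
         sd n * (D n 0 \<theta> - (\<Sum>j<4. D n j (m n) / fact j * (\<theta> - m n) ^ j)) * w n \<theta> ^ k =
         (sd n * (\<Sum>j<4. D n j (m n) / fact j * (\<theta> - m n) ^ j)) * w n \<theta> ^ k + real k * w n \<theta> ^ (k - 1)"
        using sd by (simp add: field_simps)
      then show "sd n * (D n 0 \<theta> * w n \<theta> ^ k + real k / sd n * w n \<theta> ^ (k - 1)) -
         sd n * (D n 0 \<theta> - (\<Sum>j<4. D n j (m n) / fact j * (\<theta> - m n) ^ j)) * w n \<theta> ^ k =
         a 0 n * w n \<theta> ^ k + a 1 n * w n \<theta> ^ (k+1) + a 2 n * w n \<theta> ^ (k+2)
        + a 3 n * w n \<theta> ^ (k+3) + real k * w n \<theta> ^ (k - 1)"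
        unfolding S by (simp add: algebra_simps power_add power2_eq_square)
    qed simp
    also have "\<dots> = a 0 n * \<nu> k n + a 1 n * \<nu> (k+1) n + a 2 n * \<nu> (k+2) n + a 3 n * \<nu> (k+3) n
      + real k * \<nu> (k - 1) n"
      unfolding \<nu>_def set_integral_mult_right[symmetric]
      by (simp only: set_integral_add set_integrable_cont[OF n] continuous_intros w_cont continuous_on_power
          continuous_on_mult_left)
    finally show "a 0 n * \<nu> k n + a 1 n * \<nu> (k+1) n + a 2 n * \<nu> (k+2) n + a 3 n * \<nu> (k+3) n
      + real k * \<nu> (k - 1) n = b n - R n" by simp
  qed
  then show ?thesis
    using sum_in_bigo(2)[OF b R] by (simp add: landau_o.big.in_cong)
qed

lemma \<nu>_bigo: "\<nu> k \<in> O(\<lambda>_. 1)"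
proof -
  obtain C where C: "0 < C" "\<And>n. N \<le> n \<Longrightarrow> (LINT \<theta>:J n|P n. \<bar>w n \<theta>\<bar> ^ k) \<le> C"
    using local_w_moment by metis
  show ?thesis
  proof (rule bigoI[of _ C], rule eventually_sequentiallyI[of N])
    fix n assume n: "N \<le> n"
    have "\<bar>\<nu> k n\<bar> \<le> (LINT \<theta>:J n|P n. \<bar>w n \<theta>\<bar> ^ k)"
      unfolding set_lebesgue_integral_def \<nu>_def
      by (rule order_trans[OF integral_abs_bound]) (auto simp: abs_mult power_abs)
    then show "norm (\<nu> k n) \<le> C * norm (1 :: real)" using C(2)[OF n] by simp
  qed
qed

section \<open>From local moments to the invariant cumulants\<close>

lemma standardized_moment: "(LINT z|standardized (P n). z ^ k) = (LINT \<theta>|P n. w n \<theta> ^ k)"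
proof -
  have "standardized (P n) = distr (P n) borel (w n)"
    by (simp add: standardized_def w_def[abs_def] m_def sd_def)
  then show ?thesis by (simp add: integral_distr)
qed

lemma invariant_cumulants:
  "(\<lambda>n. invariant_cumulant (P n) 3) \<in> O(\<lambda>n. 1 / sqrt n)"
  "(\<lambda>n. invariant_cumulant (P n) 4) \<in> O(\<lambda>n. (1 / sqrt n) ^ 2)"
  "(\<lambda>n. invariant_cumulant (P n) 5) \<in> O(\<lambda>n. (1 / sqrt n) ^ 3)"
proof -
  define \<mu> where "\<mu> k n = (LINT \<theta>|P n. w n \<theta> ^ k)" for k n
  have cum: "eventually (\<lambda>n. invariant_cumulant (P n) 3 = \<mu> 3 n \<and> invariant_cumulant (P n) 4 = \<mu> 4 n - 3 \<and>
      invariant_cumulant (P n) 5 = \<mu> 5 n - 10 * \<mu> 3 n) sequentially"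
  proof (rule eventually_sequentiallyI[of N])
    fix n assume n: "N \<le> n"
    show "invariant_cumulant (P n) 3 = \<mu> 3 n \<and> invariant_cumulant (P n) 4 = \<mu> 4 n - 3 \<and>
      invariant_cumulant (P n) 5 = \<mu> 5 n - 10 * \<mu> 3 n"
      using cumulants_of_standardized_moments[of "standardized (P n)"] w_moments[OF n]
      unfolding invariant_cumulant_def standardized_moment \<mu>_def by simp
  qed
  have tr: "(\<lambda>n. \<nu> k n - \<mu> k n) \<in> O(\<lambda>n. (1 / sqrt n) ^ 3)" if "k \<le> 5" for k
    unfolding \<mu>_def by (rule truncation_error[OF that])
  \<comment> \<open>The full moments of order 0, 1, 2 are exactly 1, 0, 1, so for these orders the
    truncation error is the deviation of \<open>\<nu>\<close> required by the recurrence
    lemma.\<close>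
  have \<mu>012: "eventually (\<lambda>n. \<nu> 0 n - \<mu> 0 n = \<nu> 0 n - 1 \<and> \<nu> 1 n - \<mu> 1 n = \<nu> 1 n \<and> \<nu> 2 n - \<mu> 2 n = \<nu> 2 n - 1) sequentially"
    by (rule eventually_sequentiallyI[of N]) (use w_moments in \<open>simp add: \<mu>_def\<close>)
  have n0: "(\<lambda>n. \<nu> 0 n - 1) \<in> O(\<lambda>n. (1 / sqrt n) ^ 3)"
    by (rule landau_o.big.in_cong[THEN iffD1, OF _ tr[of 0]]) (use \<mu>012 in \<open>auto elim: eventually_mono\<close>)
  have n1: "\<nu> 1 \<in> O(\<lambda>n. (1 / sqrt n) ^ 3)"
    by (rule landau_o.big.in_cong[THEN iffD1, OF _ tr[of 1]]) (use \<mu>012 in \<open>auto elim: eventually_mono\<close>)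
  have n2: "(\<lambda>n. \<nu> 2 n - 1) \<in> O(\<lambda>n. (1 / sqrt n) ^ 3)"
    by (rule landau_o.big.in_cong[THEN iffD1, OF _ tr[of 2]]) (use \<mu>012 in \<open>auto elim: eventually_mono\<close>)
  have e: "(\<lambda>n. 1 / sqrt (real n)) \<in> O(\<lambda>_. 1)" by real_asymp
  have a: "a 1 \<in> O(\<lambda>_. 1)" "a 2 \<in> O(\<lambda>n. 1 / sqrt n)" "a 3 \<in> O(\<lambda>n. (1 / sqrt n) ^ 2)"
    using a_bigo(2)[of 0] a_bigo(2)[of 1] a_bigo(2)[of 2] by (simp_all add: eval_nat_numeral)
  note rec = stein_recurrence_cumulants[OF e \<nu>_bigo n0 n1 n2 a_bigo(1)[of 0, simplified] a recurrence]
  have mono: "O(\<lambda>n. (1 / sqrt (real n)) ^ 3) \<subseteq> O(\<lambda>n. 1 / sqrt n)"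
    "O(\<lambda>n. (1 / sqrt (real n)) ^ 3) \<subseteq> O(\<lambda>n. (1 / sqrt n) ^ 2)"
    by (intro landau_o.big.subsetI, real_asymp)+
  have "(\<lambda>n. \<nu> 3 n - (\<nu> 3 n - \<mu> 3 n)) \<in> O(\<lambda>n. 1 / sqrt n)"
    by (rule sum_in_bigo(2)[OF rec(1) subsetD[OF mono(1) tr]]) simp
  then have 3: "(\<lambda>n. \<mu> 3 n) \<in> O(\<lambda>n. 1 / sqrt n)" by simp
  have "(\<lambda>n. (\<nu> 4 n - 3) - (\<nu> 4 n - \<mu> 4 n)) \<in> O(\<lambda>n. (1 / sqrt n) ^ 2)"
    by (rule sum_in_bigo(2)[OF rec(2) subsetD[OF mono(2) tr]]) simp
  then have 4: "(\<lambda>n. \<mu> 4 n - 3) \<in> O(\<lambda>n. (1 / sqrt n) ^ 2)" by simp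
  have "(\<lambda>n. (\<nu> 5 n - 10 * \<nu> 3 n) - ((\<nu> 5 n - \<mu> 5 n) - 10 * (\<nu> 3 n - \<mu> 3 n))) \<in> O(\<lambda>n. (1 / sqrt n) ^ 3)"
    using tr[of 3] by (intro sum_in_bigo(2)[OF rec(3) sum_in_bigo(2)[OF tr]]) (simp_all del: right_diff_distrib_numeral)
  then have 5: "(\<lambda>n. \<mu> 5 n - 10 * \<mu> 3 n) \<in> O(\<lambda>n. (1 / sqrt n) ^ 3)" by (simp add: algebra_simps)
  show "(\<lambda>n. invariant_cumulant (P n) 3) \<in> O(\<lambda>n. 1 / sqrt n)"
    by (rule landau_o.big.in_cong[THEN iffD2, OF _ 3]) (use cum in \<open>auto elim: eventually_mono\<close>)
  show "(\<lambda>n. invariant_cumulant (P n) 4) \<in> O(\<lambda>n. (1 / sqrt n) ^ 2)"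
    by (rule landau_o.big.in_cong[THEN iffD2, OF _ 4]) (use cum in \<open>auto elim: eventually_mono\<close>)
  show "(\<lambda>n. invariant_cumulant (P n) 5) \<in> O(\<lambda>n. (1 / sqrt n) ^ 3)"
    by (rule landau_o.big.in_cong[THEN iffD2, OF _ 5]) (use cum in \<open>auto elim: eventually_mono\<close>)
qed

end

section \<open>Laplace bounds for the posterior\<close>

lemma Ck_on_has_derivative:
  assumes "Ck_on k g S" "j < k" "u \<in> S"
  shows "((deriv ^^ j) g has_real_derivative (deriv ^^ Suc j) g u) (at u)"
  using assms by (simp add: Ck_on_def DERIV_deriv_iff_real_differentiable)

lemma Ck_on_continuous:
  assumes "Ck_on k g S" "j \<le> k"
  shows "continuous_on S ((deriv ^^ j) g)"
proof (cases "j = k")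
  case False
  then show ?thesis
    using Ck_on_has_derivative[OF assms(1), of j] assms(2)
    by (auto intro!: continuous_at_imp_continuous_on DERIV_isCont)
qed (use assms in \<open>simp add: Ck_on_def\<close>)

text \<open>At a maximum, a second derivative of constant modulus at least \<open>c\<close> can only be negative: the
  Lagrange point of the Taylor expansion already has the right sign.\<close>
lemma quadratic_bounds_at_maximum:
  fixes g :: "real \<Rightarrow> real" and a \<epsilon> :: real
  defines "S \<equiv> {a - \<epsilon> <..< a + \<epsilon>}"
  assumes \<epsilon>: "0 < \<epsilon>" and g: "Ck_on k g S" "2 \<le> k" and max: "\<And>u. u \<in> S \<Longrightarrow> g u \<le> g a"
    and c: "0 < c" "\<And>u. u \<in> S \<Longrightarrow> c \<le> \<bar>(deriv ^^ 2) g u\<bar>"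
  shows "deriv g a = 0"
    and "u \<in> S \<Longrightarrow> g u \<le> g a - c / 2 * (u - a)\<^sup>2"
    and "u \<in> S \<Longrightarrow> (\<And>v. v \<in> S \<Longrightarrow> \<bar>(deriv ^^ 2) g v\<bar> \<le> B) \<Longrightarrow> g a - B / 2 * (u - a)\<^sup>2 \<le> g u"
proof -
  have a: "a \<in> S" using \<epsilon> by (simp add: S_def)
  have d: "((deriv ^^ j) g has_real_derivative (deriv ^^ Suc j) g v) (at v)" if "j < 2" "v \<in> S" for j v
    using Ck_on_has_derivative[OF g(1)] that g(2) by simp
  show d0: "deriv g a = 0"
  proof (rule DERIV_local_max)
    show "(g has_real_derivative deriv g a) (at a)" using d[of 0 a] a by simp
    show "\<forall>y. \<bar>a - y\<bar> < \<epsilon> \<longrightarrow> g y \<le> g a" using max by (auto simp: S_def abs_less_iff)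
  qed (rule \<epsilon>)
  have taylor: "\<exists>v\<in>S. g u = g a + (deriv ^^ 2) g v / 2 * (u - a)\<^sup>2" if u: "u \<in> S" "u \<noteq> a" for u
  proof -
    have dd: "((deriv ^^ j) g has_real_derivative deriv ((deriv ^^ j) g) v) (at v)"
      if "j < 2" "min a u \<le> v" "v \<le> max a u" for j v
    proof -
      have "v \<in> S" using that u(1) a by (auto simp: S_def)
      then show ?thesis using d[OF that(1)] by simp
    qed
    have "\<exists>v. (if u < a then u < v \<and> v < a else a < v \<and> v < u) \<and>
        g u = (\<Sum>j<2. (deriv ^^ j) g a / fact j * (u - a) ^ j) + (deriv ^^ 2) g v / fact 2 * (u - a) ^ 2"
      by (rule Taylor[of 2 "\<lambda>j. (deriv ^^ j) g" g "min a u" "max a u"])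
        (use dd u in auto)
    then obtain v where v: "if u < a then u < v \<and> v < a else a < v \<and> v < u"
      "g u = (\<Sum>j<2. (deriv ^^ j) g a / fact j * (u - a) ^ j) + (deriv ^^ 2) g v / fact 2 * (u - a) ^ 2" by blast
    have "v \<in> S" using v(1) u a by (auto simp: S_def split: if_splits)
    moreover have "{..<2} = {0, 1 :: nat}" by auto
    ultimately show ?thesis using v(2) d0 by auto
  qed
  show "g u \<le> g a - c / 2 * (u - a)\<^sup>2" if u: "u \<in> S"
  proof (cases "u = a")
    case False
    then obtain v where v: "v \<in> S" "g u = g a + (deriv ^^ 2) g v / 2 * (u - a)\<^sup>2" using taylor u by blast
    have "0 < (u - a)\<^sup>2" using False by simp
    moreover have "(deriv ^^ 2) g v / 2 * (u - a)\<^sup>2 \<le> 0" using max[OF u] v by linarith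
    ultimately have "(deriv ^^ 2) g v \<le> 0" by (simp add: mult_le_0_iff)
    then have "(deriv ^^ 2) g v / 2 \<le> - c / 2" using c(2)[OF v(1)] by linarith
    from mult_right_mono[OF this, of "(u - a)\<^sup>2"] show ?thesis using v(2) by simp
  qed simp
  show "g a - B / 2 * (u - a)\<^sup>2 \<le> g u"
    if u: "u \<in> S" and B: "\<And>v. v \<in> S \<Longrightarrow> \<bar>(deriv ^^ 2) g v\<bar> \<le> B"
  proof (cases "u = a")
    case False
    then obtain v where v: "v \<in> S" "g u = g a + (deriv ^^ 2) g v / 2 * (u - a)\<^sup>2" using taylor u by blast
    have "- (B / 2) \<le> (deriv ^^ 2) g v / 2" using B[OF v(1)] by linarith
    from mult_right_mono[OF this, of "(u - a)\<^sup>2"] show ?thesis using v(2) by simp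
  qed simp
qed

text \<open>One function, here the log prior, has to be bounded near infinitely many centres. The
  points within \<epsilon>/2 of the closure of the bounded set of centres form a compact set, and it
  lies in the union of the open neighborhoods, where the derivatives are continuous. Halving
  \<epsilon> leaves room to replace a limit of centres by a centre.\<close>

lemma uniform_derivative_bound:
  fixes g :: "real \<Rightarrow> real" and t :: "'i \<Rightarrow> real"
  assumes \<epsilon>: "0 < \<epsilon>" and bdd: "bounded (t ` I)"
    and g: "\<And>i. i \<in> I \<Longrightarrow> Ck_on k g {t i - \<epsilon> <..< t i + \<epsilon>}"
  obtains G where "0 \<le> G"
    "\<And>i j u. i \<in> I \<Longrightarrow> j \<le> k \<Longrightarrow> \<bar>u - t i\<bar> \<le> \<epsilon> / 2 \<Longrightarrow> \<bar>(deriv ^^ j) g u\<bar> \<le> G"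
proof -
  define S where "S = {y + z | y z. y \<in> closure (t ` I) \<and> z \<in> cball 0 (\<epsilon> / 2)}"
  define W where "W = (\<Union>i\<in>I. {t i - \<epsilon> <..< t i + \<epsilon>})"
  have "compact S"
    unfolding S_def by (intro compact_sums compact_cball) (simp add: bdd)
  have "S \<subseteq> W"
  proof
    fix v assume "v \<in> S"
    then obtain y z where v: "v = y + z" "y \<in> closure (t ` I)" "\<bar>z\<bar> \<le> \<epsilon> / 2"
      by (auto simp: S_def)
    then obtain i where i: "i \<in> I" "\<bar>t i - y\<bar> < \<epsilon> / 2"
      using \<epsilon> by (auto simp: closure_approachable dist_real_def dest!: spec[of _ "\<epsilon> / 2"])
    then have "t i - \<epsilon> < v" "v < t i + \<epsilon>" using v by linarith+
    then show "v \<in> W" using i by (auto simp: W_def)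
  qed
  have "continuous_on W ((deriv ^^ j) g)" if "j \<le> k" for j
    unfolding W_def using g that by (intro continuous_on_open_UN Ck_on_continuous) auto
  then have "bounded (\<Union>j\<in>{..k}. (deriv ^^ j) g ` S)"
    using \<open>compact S\<close> \<open>S \<subseteq> W\<close>
    by (intro bounded_UN) (auto intro!: compact_imp_bounded compact_continuous_image intro: continuous_on_subset)
  then obtain G where G: "0 < G" "\<And>y. y \<in> (\<Union>j\<in>{..k}. (deriv ^^ j) g ` S) \<Longrightarrow> norm y \<le> G"
    unfolding bounded_pos by blast
  have "\<bar>(deriv ^^ j) g u\<bar> \<le> G" if "i \<in> I" "j \<le> k" "\<bar>u - t i\<bar> \<le> \<epsilon> / 2" for i j u
  proof -
    have "t i \<in> closure (t ` I)" using that(1) by (simp add: closure_subset[THEN subsetD])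
    then have "u \<in> S" unfolding S_def using that(3)
      by (intro CollectI exI[of _ "t i"] exI[of _ "u - t i"]) auto
    then show ?thesis using G(2)[of "(deriv ^^ j) g u"] that(2) by auto
  qed
  then show ?thesis using G(1) by (intro that[of G]) auto
qed

text \<open>Splitting at \<open>1 + \<bar>\<theta>\<bar> = R\<close> trades the moment of order \<open>p > 5\<close> for a small power of \<open>1 / R\<close>.\<close>
lemma fifth_moment_split:
  fixes P :: "real measure"
  assumes "prob_space P" and [measurable_cong]: "sets P = sets borel" and A [measurable]: "A \<in> sets borel" and p: "5 < p"
    and C: "0 \<le> C" "(\<integral>\<^sup>+\<theta>. ennreal (\<bar>\<theta>\<bar> powr p) \<partial>P) \<le> ennreal C" and R: "1 \<le> R"
  shows "integrable P (\<lambda>\<theta>. (1 + \<bar>\<theta>\<bar>) ^ 5)"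
    and "(LINT \<theta>:A|P. (1 + \<bar>\<theta>\<bar>) ^ 5) \<le> R ^ 5 * measure P A + 2 powr p * (1 + C) * R powr (5 - p)"
proof -
  interpret prob_space P by fact
  have ip: "integrable P (\<lambda>\<theta>. \<bar>\<theta>\<bar> powr p)"
    by (rule integrableI_bounded) (use C(2) in \<open>auto intro: le_less_trans\<close>)
  have ip_le: "(LINT \<theta>|P. \<bar>\<theta>\<bar> powr p) \<le> C"
    using C by (intro integral_real_bounded) auto
  have split: "(1 + \<bar>\<theta>\<bar>) ^ 5 \<le> R ^ 5 \<or> (1 + \<bar>\<theta>\<bar>) ^ 5 \<le> 2 powr p * (1 + \<bar>\<theta>\<bar> powr p) * R powr (5 - p)"
    if "1 \<le> R" for R \<theta>
  proof (cases "1 + \<bar>\<theta>\<bar> \<le> R")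
    case False
    \<comment> \<open>Beyond \<open>R\<close> the surplus factor has the negative exponent 5 - p, so
      it is largest at \<open>R\<close>.\<close>
    have "(1 + \<bar>\<theta>\<bar>) ^ 5 = (1 + \<bar>\<theta>\<bar>) powr p * (1 + \<bar>\<theta>\<bar>) powr (5 - p)"
      by (simp flip: powr_add)
    also have "\<dots> \<le> (2 powr p * (1 + \<bar>\<theta>\<bar> powr p)) * R powr (5 - p)"
    proof (intro mult_mono)
      have "(1 + \<bar>\<theta>\<bar>) powr p \<le> (2 * max 1 \<bar>\<theta>\<bar>) powr p" using p by (intro powr_mono2) auto
      also have "\<dots> = 2 powr p * max 1 \<bar>\<theta>\<bar> powr p" by (simp add: powr_mult)
      also have "\<dots> \<le> 2 powr p * (1 + \<bar>\<theta>\<bar> powr p)" by (intro mult_left_mono) (auto simp: max_def)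
      finally show "(1 + \<bar>\<theta>\<bar>) powr p \<le> 2 powr p * (1 + \<bar>\<theta>\<bar> powr p)" .
      show "(1 + \<bar>\<theta>\<bar>) powr (5 - p) \<le> R powr (5 - p)"
        using False p that by (intro powr_mono2') auto
    qed auto
    finally show ?thesis by simp
  qed (auto intro: power_mono)
  have i: "integrable P (\<lambda>\<theta>. 2 powr p * (1 + \<bar>\<theta>\<bar> powr p) * R powr (5 - p))" for R
    using ip by simp
  have i1: "integrable P (\<lambda>\<theta>. 1 + 2 powr p * (1 + \<bar>\<theta>\<bar> powr p) * 1 powr (5 - p))"
    using ip by simp
  show i5: "integrable P (\<lambda>\<theta>. (1 + \<bar>\<theta>\<bar>) ^ 5)"
  proof (rule Bochner_Integration.integrable_bound[OF i1], measurable, rule AE_I2)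
    fix \<theta>
    show "norm ((1 + \<bar>\<theta>\<bar>) ^ 5) \<le> norm (1 + 2 powr p * (1 + \<bar>\<theta>\<bar> powr p) * 1 powr (5 - p))"
      using split[of 1 \<theta>] by (auto intro: add_increasing add_increasing2)
  qed
  have iA: "integrable P (\<lambda>\<theta>. R ^ 5 * indicator A \<theta>)"
    by (rule integrable_const_bound[of _ "R ^ 5"]) (use R in \<open>auto split: split_indicator\<close>)
  have "(LINT \<theta>:A|P. (1 + \<bar>\<theta>\<bar>) ^ 5) \<le> (LINT \<theta>|P. R ^ 5 * indicator A \<theta> + 2 powr p * (1 + \<bar>\<theta>\<bar> powr p) * R powr (5 - p))"
    unfolding set_lebesgue_integral_def
  proof (intro integral_mono integrable_mult_indicator i5 Bochner_Integration.integrable_add iA i)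
    fix \<theta>
    show "indicator A \<theta> *\<^sub>R (1 + \<bar>\<theta>\<bar>) ^ 5 \<le> R ^ 5 * indicator A \<theta> + 2 powr p * (1 + \<bar>\<theta>\<bar> powr p) * R powr (5 - p)"
      using split[OF R, of \<theta>] R
      by (cases "\<theta> \<in> A") (auto intro: add_increasing add_increasing2)
  qed simp
  also have "\<dots> = R ^ 5 * measure P A + 2 powr p * (1 + (LINT \<theta>|P. \<bar>\<theta>\<bar> powr p)) * R powr (5 - p)"
    using iA i ip prob_space sets_eq_imp_space_eq[OF assms(2)] by (simp add: Int_absorb2)
  also have "\<dots> \<le> R ^ 5 * measure P A + 2 powr p * (1 + C) * R powr (5 - p)"
    using ip_le by (intro add_left_mono mult_right_mono mult_left_mono) auto
  finally show "(LINT \<theta>:A|P. (1 + \<bar>\<theta>\<bar>) ^ 5) \<le> R ^ 5 * measure P A + 2 powr p * (1 + C) * R powr (5 - p)" .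
qed

section \<open>Bounds for the likelihood, the normalizing constant and the posterior density\<close>

text \<open>The existential constants of the hypotheses become parameters, with one threshold
  \<open>N0\<close> for those that hold only eventually. The log prior bound \<open>G\<close> is
  confined to the half neighborhood, because it comes from compactness.\<close>

locale regular_posterior = bayes_model M \<Theta> f prior
  for M :: "'a measure" and \<Theta> :: "real set" and f :: "'a \<Rightarrow> real \<Rightarrow> real" and prior :: "real \<Rightarrow> real" +
  fixes x :: "nat \<Rightarrow> 'a" and t :: "nat \<Rightarrow> real" and \<epsilon> \<delta> c B G T p C :: real and N0 :: nat
    and U :: "nat \<Rightarrow> real set"
  defines "U \<equiv> \<lambda>n. {t n - \<epsilon> <..< t n + \<epsilon>}"
  assumes data: "1 \<le> i \<Longrightarrow> x i \<in> space M"
    and maximizer: "1 \<le> n \<Longrightarrow> unique_global_maximizer (likelihood f x n) \<Theta> (t n)"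
    and pos: "0 < \<epsilon>" "0 < \<delta>" "0 < c" "0 \<le> B" "0 \<le> G" "0 < T" "5 < p" "0 \<le> C"
    and U_pos: "1 \<le> n \<Longrightarrow> \<theta> \<in> U n \<Longrightarrow> \<theta> \<in> \<Theta> \<and> 0 < likelihood f x n \<theta> \<and> 0 < prior \<theta>"
    and loglik_smooth: "1 \<le> n \<Longrightarrow> Ck_on 6 (avg_loglik f x n) (U n)"
    and logprior_smooth: "1 \<le> n \<Longrightarrow> Ck_on 6 (\<lambda>\<theta>. ln (prior \<theta>)) (U n)"
    and separation: "1 \<le> n \<Longrightarrow> \<theta> \<in> \<Theta> - U n \<Longrightarrow> 0 < likelihood f x n \<theta> \<Longrightarrow>
        avg_loglik f x n \<theta> < avg_loglik f x n (t n) - \<delta>"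
    and curvature: "1 \<le> n \<Longrightarrow> \<theta> \<in> U n \<Longrightarrow> c \<le> \<bar>(deriv ^^ 2) (avg_loglik f x n) \<theta>\<bar>"
    and t_le: "1 \<le> n \<Longrightarrow> \<bar>t n\<bar> \<le> T"
    and loglik_deriv_le: "N0 \<le> n \<Longrightarrow> \<theta> \<in> U n \<Longrightarrow> j \<in> {1..6} \<Longrightarrow> \<bar>(deriv ^^ j) (avg_loglik f x n) \<theta>\<bar> \<le> B"
    and logprior_deriv_le: "1 \<le> n \<Longrightarrow> j \<le> 6 \<Longrightarrow> \<bar>\<theta> - t n\<bar> \<le> \<epsilon> / 2 \<Longrightarrow> \<bar>(deriv ^^ j) (\<lambda>\<theta>. ln (prior \<theta>)) \<theta>\<bar> \<le> G"
    and moments: "N0 \<le> n \<Longrightarrow> (\<integral>\<^sup>+\<theta>. ennreal (\<bar>\<theta>\<bar> powr p) \<partial>posterior \<Theta> f prior x n) \<le> ennreal C"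
begin

abbreviation "L \<equiv> likelihood f x"
abbreviation "l \<equiv> avg_loglik f x"
abbreviation "lp \<equiv> \<lambda>\<theta>. ln (prior \<theta>)"
abbreviation "q \<equiv> posterior_density \<Theta> f prior x"

definition Z :: "nat \<Rightarrow> real" where "Z n = (LINT \<theta>:\<Theta>|lborel. L n \<theta> * prior \<theta>)"

lemma Z_altdef: "Z n = (LINT \<theta>|lborel. indicator \<Theta> \<theta> * (L n \<theta> * prior \<theta>))"
  by (simp add: Z_def set_lebesgue_integral_def)

lemma q_altdef: "q n \<theta> = indicator \<Theta> \<theta> * (L n \<theta> * prior \<theta>) / Z n"
  by (simp add: posterior_density_def Z_def)

lemma L_nonneg: "\<theta> \<in> \<Theta> \<Longrightarrow> 0 \<le> L n \<theta>"
  unfolding likelihood_def using f_nonneg data by (intro prod_nonneg) auto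

lemma kernel_nonneg: "0 \<le> indicator \<Theta> \<theta> * (L n \<theta> * prior \<theta>)"
  using L_nonneg prior_nonneg by (auto split: split_indicator)

lemma kernel_meas [measurable]: "(\<lambda>\<theta>. indicator \<Theta> \<theta> * (L n \<theta> * prior \<theta>)) \<in> borel_measurable borel"
proof -
  have "(\<lambda>\<theta>. f (x i) \<theta>) \<in> borel_measurable (restrict_space borel \<Theta>)" if "1 \<le> i" for i
    using measurable_Pair2[OF f_measurable data[OF that]] by simp
  then have "L n \<in> borel_measurable (restrict_space borel \<Theta>)"
    unfolding likelihood_def[abs_def] by (intro borel_measurable_prod) auto
  then have "(\<lambda>\<theta>. indicator \<Theta> \<theta> *\<^sub>R L n \<theta>) \<in> borel_measurable borel"
    using \<Theta>_borel by (subst (asm) borel_measurable_restrict_space_iff) auto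
  moreover have "(\<lambda>\<theta>. indicator \<Theta> \<theta> *\<^sub>R prior \<theta>) \<in> borel_measurable borel"
    using prior_measurable by (simp add: set_borel_measurable_def)
  ultimately have "(\<lambda>\<theta>. (indicator \<Theta> \<theta> *\<^sub>R L n \<theta>) * (indicator \<Theta> \<theta> *\<^sub>R prior \<theta>)) \<in> borel_measurable borel"
    by (rule borel_measurable_times)
  also have "(\<lambda>\<theta>. (indicator \<Theta> \<theta> *\<^sub>R L n \<theta>) * (indicator \<Theta> \<theta> *\<^sub>R prior \<theta>)) =
      (\<lambda>\<theta>. indicator \<Theta> \<theta> * (L n \<theta> * prior \<theta>))"
    by (auto split: split_indicator)
  finally show ?thesis .
qed

lemma q_meas [measurable]: "q n \<in> borel_measurable borel"
  unfolding q_altdef[abs_def] by measurable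

lemma q_nonneg: "0 \<le> q n \<theta>"
  unfolding q_altdef Z_altdef
  by (intro divide_nonneg_nonneg kernel_nonneg Bochner_Integration.integral_nonneg)

lemma prior_integral: "has_bochner_integral lborel (\<lambda>\<theta>. indicator \<Theta> \<theta> * prior \<theta>) 1"
proof (rule has_bochner_integral_nn_integral)
  show "(\<lambda>\<theta>. indicator \<Theta> \<theta> * prior \<theta>) \<in> borel_measurable lborel"
    using prior_measurable by (simp add: set_borel_measurable_def)
  show "AE \<theta> in lborel. 0 \<le> indicator \<Theta> \<theta> * prior \<theta>"
    using prior_nonneg by (auto split: split_indicator)
  have "(\<integral>\<^sup>+\<theta>. ennreal (indicator \<Theta> \<theta> * prior \<theta>) \<partial>lborel) = (\<integral>\<^sup>+\<theta>\<in>\<Theta>. ennreal (prior \<theta>) \<partial>lborel)"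
    by (intro nn_integral_cong) (auto split: split_indicator)
  then show "(\<integral>\<^sup>+\<theta>. ennreal (indicator \<Theta> \<theta> * prior \<theta>) \<partial>lborel) = ennreal 1"
    using prior_density by simp
qed simp

lemma t_in: "t n \<in> U n"
  using pos by (simp add: U_def)

lemma L_max: "1 \<le> n \<Longrightarrow> \<theta> \<in> \<Theta> \<Longrightarrow> L n \<theta> \<le> L n (t n)"
  using maximizer unfolding unique_global_maximizer_def by (metis less_imp_le order_refl)

lemma Lt_pos: "1 \<le> n \<Longrightarrow> 0 < L n (t n)"
  using U_pos t_in by blast

lemma kernel_integrable: "1 \<le> n \<Longrightarrow> integrable lborel (\<lambda>\<theta>. indicator \<Theta> \<theta> * (L n \<theta> * prior \<theta>))"
proof (rule Bochner_Integration.integrable_bound[of lborel "\<lambda>\<theta>. L n (t n) * (indicator \<Theta> \<theta> * prior \<theta>)"])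
  assume n: "1 \<le> n"
  show "integrable lborel (\<lambda>\<theta>. L n (t n) * (indicator \<Theta> \<theta> * prior \<theta>))"
    using prior_integral by (intro integrable_mult_right) (auto simp: has_bochner_integral_iff)
  show "AE \<theta> in lborel. norm (indicator \<Theta> \<theta> * (L n \<theta> * prior \<theta>)) \<le> norm (L n (t n) * (indicator \<Theta> \<theta> * prior \<theta>))"
    using L_max[OF n] Lt_pos[OF n] L_nonneg prior_nonneg
    by (auto split: split_indicator simp: abs_mult intro!: mult_right_mono)
qed simp

lemma L_exp: "1 \<le> n \<Longrightarrow> 0 < L n \<theta> \<Longrightarrow> L n \<theta> = exp (n * l n \<theta>)"
  by (simp add: avg_loglik_def loglik_def)

lemma L_ratio:
  assumes "1 \<le> n" "0 < L n \<theta>"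
  shows "L n \<theta> / L n (t n) = exp (n * (l n \<theta> - l n (t n)))"
  using assms Lt_pos[OF assms(1)] by (simp add: L_exp exp_diff[symmetric] right_diff_distrib)

lemma l_max: "1 \<le> n \<Longrightarrow> \<theta> \<in> U n \<Longrightarrow> l n \<theta> \<le> l n (t n)"
  using L_max U_pos by (auto simp: avg_loglik_def loglik_def Lt_pos intro!: divide_right_mono)

lemma
  assumes n: "1 \<le> n"
  shows score_zero: "deriv (l n) (t n) = 0"
    and l_upper: "\<theta> \<in> U n \<Longrightarrow> l n \<theta> \<le> l n (t n) - c / 2 * (\<theta> - t n)\<^sup>2"
  using quadratic_bounds_at_maximum(1,2)[OF pos(1) loglik_smooth[OF n, unfolded U_def] _ _ pos(3)]
    curvature[OF n] l_max[OF n] unfolding U_def by auto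

lemma l_lower:
  assumes n: "1 \<le> n" "N0 \<le> n" and \<theta>: "\<theta> \<in> U n"
  shows "l n (t n) - B / 2 * (\<theta> - t n)\<^sup>2 \<le> l n \<theta>"
proof -
  have "\<bar>(deriv ^^ 2) (l n) v\<bar> \<le> B" if "v \<in> U n" for v
    using loglik_deriv_le[OF n(2) that, of 2] by simp
  then show ?thesis
    using quadratic_bounds_at_maximum(3)[OF pos(1) loglik_smooth[OF n(1), unfolded U_def] _ _ pos(3)]
      curvature[OF n(1)] l_max[OF n(1)] \<theta> unfolding U_def by auto
qed

lemma half_subset: "\<bar>\<theta> - t n\<bar> \<le> \<epsilon> / 2 \<Longrightarrow> \<theta> \<in> U n"
  using pos(1) unfolding U_def greaterThanLessThan_iff by linarith

lemma prior_bounds: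
  assumes n: "1 \<le> n" and \<theta>: "\<bar>\<theta> - t n\<bar> \<le> \<epsilon> / 2"
  shows "exp (- G) \<le> prior \<theta>" "prior \<theta> \<le> exp G"
proof -
  have "\<bar>ln (prior \<theta>)\<bar> \<le> G" using logprior_deriv_le[OF n _ \<theta>, of 0] by simp
  moreover have "0 < prior \<theta>" using U_pos[OF n half_subset[OF \<theta>]] by simp
  ultimately show "exp (- G) \<le> prior \<theta>" "prior \<theta> \<le> exp G"
    by (simp_all add: abs_le_iff ln_ge_iff[symmetric] minus_le_iff) (metis exp_le_cancel_iff exp_ln)
qed

text \<open>The last condition makes the window of radius \<open>1 / sqrt n\<close> that bounds
  \<open>Z n\<close> from below fit into the half neighborhood.\<close>

definition good :: "nat \<Rightarrow> bool" where
  "good n \<longleftrightarrow> 1 \<le> n \<and> N0 \<le> n \<and> 1 / sqrt n \<le> \<epsilon> / 2"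

lemma eventually_good: "eventually good sequentially"
proof -
  have "eventually (\<lambda>n. 1 / sqrt (real n) < \<epsilon> / 2) sequentially" using pos by real_asymp
  then show ?thesis
    using eventually_ge_at_top[of 1] eventually_ge_at_top[of N0]
    by eventually_elim (auto simp: good_def)
qed

text \<open>Within \<open>1 / sqrt n\<close> of the maximizer the loglikelihood drops by at most n *
  (B/2) * (1/n) = B/2 and the prior is at least \<open>exp (- G)\<close>. The window has length
  \<open>2 / sqrt n\<close>, which already gives the right order of the Laplace integral.\<close>

lemma Z_lower:
  assumes "good n"
  shows "2 * exp (- (G + B / 2)) * L n (t n) / sqrt n \<le> Z n"
proof -
  have n: "1 \<le> n" "N0 \<le> n" "1 / sqrt n \<le> \<epsilon> / 2" using assms by (auto simp: good_def)
  define r where "r = 1 / sqrt n"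
  have r: "0 < r" "r \<le> \<epsilon> / 2" "r\<^sup>2 = 1 / n" using n by (auto simp: r_def power_divide)
  let ?k = "L n (t n) * exp (- (G + B / 2))"
  have "?k * (2 * r) = (LINT \<theta>|lborel. ?k * indicator {t n - r..t n + r} \<theta>)"
    using r by simp
  also have "\<dots> \<le> Z n"
    unfolding Z_altdef
  proof (intro integral_mono kernel_integrable n)
    fix \<theta>
    show "?k * indicator {t n - r..t n + r} \<theta> \<le> indicator \<Theta> \<theta> * (L n \<theta> * prior \<theta>)"
    proof (cases "\<theta> \<in> {t n - r..t n + r}")
      case True
      then have \<theta>: "\<bar>\<theta> - t n\<bar> \<le> r" by auto
      then have h: "\<bar>\<theta> - t n\<bar> \<le> \<epsilon> / 2" using r by simp
      note U = half_subset[OF h]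
      have "(\<theta> - t n)\<^sup>2 \<le> 1 / n" using \<theta> r(1) by (simp add: r(3)[symmetric] abs_le_square_iff[symmetric])
      then have "n * (B / 2 * (\<theta> - t n)\<^sup>2) \<le> n * (B / 2 * (1 / n))"
        using pos by (intro mult_left_mono) auto
      also have "\<dots> = B / 2" using n by simp
      finally have "exp (- (B / 2)) \<le> exp (n * (l n \<theta> - l n (t n)))"
        using mult_left_mono[OF l_lower[OF n(1,2) U], of "real n"] by (simp add: right_diff_distrib)
      also have "\<dots> = L n \<theta> / L n (t n)" using U_pos[OF n(1) U] n(1) by (intro L_ratio[symmetric]) auto
      finally have "L n (t n) * exp (- (B / 2)) \<le> L n \<theta>"
        using Lt_pos[OF n(1)] by (simp add: field_simps)
      then have "(L n (t n) * exp (- (B / 2))) * exp (- G) \<le> L n \<theta> * prior \<theta>"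
        using U_pos[OF n(1) U] prior_bounds(1)[OF n(1) h] by (intro mult_mono) auto
      moreover have "exp (- (G + B / 2)) = exp (- (B / 2)) * exp (- G)" by (simp add: exp_add[symmetric])
      ultimately have "?k \<le> L n \<theta> * prior \<theta>" by (metis mult.assoc)
      then show ?thesis using True U_pos[OF n(1) U] by simp
    qed (use kernel_nonneg in auto)
  qed (intro integrable_mult_right integrable_real_indicator; simp add: emeasure_lborel_Icc_eq)
  finally show ?thesis by (simp add: r_def mult_ac)
qed

lemma Z_pos: "good n \<Longrightarrow> 0 < Z n"
  using Z_lower[of n] Lt_pos[of n]
  by (smt (verit) good_def divide_pos_pos exp_gt_zero mult_pos_pos of_nat_0_less_iff real_sqrt_gt_zero less_le_trans zero_less_one)

lemma prob_posterior: "good n \<Longrightarrow> prob_space (posterior \<Theta> f prior x n)"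
proof
  assume n: "good n"
  then have n1: "1 \<le> n" by (simp add: good_def)
  have "(\<integral>\<^sup>+\<theta>. ennreal (q n \<theta>) \<partial>lborel) = ennreal (LINT \<theta>|lborel. q n \<theta>)"
    using kernel_integrable[OF n1] q_nonneg
    by (intro nn_integral_eq_integral) (auto simp: q_altdef[abs_def])
  also have "(LINT \<theta>|lborel. q n \<theta>) = Z n / Z n"
    by (simp add: q_altdef Z_altdef)
  finally show "emeasure (posterior \<Theta> f prior x n) (space (posterior \<Theta> f prior x n)) = 1"
    using Z_pos[OF n] by (simp add: posterior_def emeasure_density)
qed

lemma q_upper:
  assumes n: "good n" and \<theta>: "\<theta> \<in> \<Theta>" and e: "L n \<theta> / L n (t n) \<le> e"
  shows "q n \<theta> \<le> exp (G + B / 2) / 2 * sqrt n * e * prior \<theta>"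
proof -
  have n1: "1 \<le> n" using n by (simp add: good_def)
  have n0: "0 < sqrt n" using n1 by simp
  have "q n \<theta> = L n \<theta> * prior \<theta> / Z n" using \<theta> by (simp add: q_altdef)
  also have "\<dots> \<le> L n \<theta> * prior \<theta> / (2 * exp (- (G + B / 2)) * L n (t n) / sqrt n)"
    using Z_lower[OF n] Z_pos[OF n] Lt_pos[OF n1] n0 L_nonneg[OF \<theta>] prior_nonneg[OF \<theta>]
    by (intro divide_left_mono) auto
  also have "\<dots> = exp (G + B / 2) / 2 * sqrt n * (L n \<theta> / L n (t n)) * prior \<theta>"
    by (simp add: exp_minus field_simps)
  also have "\<dots> \<le> exp (G + B / 2) / 2 * sqrt n * e * prior \<theta>"
    using e n0 prior_nonneg[OF \<theta>] by (intro mult_right_mono mult_left_mono) auto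
  finally show ?thesis .
qed

text \<open>The quadratic upper bound n c/2 (\<theta> - t)^2 is the exponent of a normal density of
  variance 1/(c n), and the factor \<open>sqrt n\<close> from the normalizing constant is matched by
  the peak height of that density.\<close>

lemma q_local_upper:
  assumes n: "good n" and \<theta>: "\<bar>\<theta> - t n\<bar> \<le> \<epsilon> / 2"
  shows "q n \<theta> \<le> exp (2 * G + B / 2) / 2 * sqrt (2 * pi) / sqrt c * normal_density (t n) (1 / sqrt c / sqrt n) \<theta>"
proof -
  have n1: "1 \<le> n" using n by (simp add: good_def)
  note U = half_subset[OF \<theta>]
  have U': "\<theta> \<in> \<Theta>" "0 < L n \<theta>" using U_pos[OF n1 U] by auto
  let ?e = "exp (- (n * c / 2) * (\<theta> - t n)\<^sup>2)"
  have "L n \<theta> / L n (t n) \<le> ?e"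
    using mult_left_mono[OF l_upper[OF n1 U], of "real n"]
    by (simp add: L_ratio[OF n1 U'(2)] algebra_simps)
  then have "q n \<theta> \<le> exp (G + B / 2) / 2 * sqrt n * ?e * prior \<theta>"
    by (rule q_upper[OF n U'(1)])
  also have "\<dots> \<le> exp (G + B / 2) / 2 * sqrt n * ?e * exp G"
    using prior_bounds(2)[OF n1 \<theta>] by (intro mult_left_mono) auto
  also have "\<dots> = exp (2 * G + B / 2) / 2 * (sqrt n * ?e)"
  proof -
    have "exp (2 * G + B / 2) = exp (G + B / 2) * exp G" by (simp add: exp_add[symmetric])
    then show ?thesis by simp
  qed
  also have "sqrt n * ?e = sqrt (2 * pi) / sqrt c * normal_density (t n) (1 / sqrt c / sqrt n) \<theta>"
  proof -
    have sq: "(1 / sqrt c / sqrt n)\<^sup>2 = 1 / (c * n)" using pos n1 by (simp add: power_divide power_mult_distrib)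
    have "1 / sqrt (2 * pi * (1 / (c * n))) = sqrt c * sqrt n / sqrt (2 * pi)"
      using pos n1 by (simp add: real_sqrt_mult real_sqrt_divide)
    moreover have "- (\<theta> - t n)\<^sup>2 / (2 * (1 / (c * n))) = - (n * c / 2) * (\<theta> - t n)\<^sup>2"
      by (simp add: field_simps)
    ultimately show ?thesis using pos unfolding normal_density_def sq by simp
  qed
  finally show ?thesis by (simp add: mult.assoc)
qed

text \<open>The loglikelihood gap outside the half neighborhood: the quadratic bound at distance
  \<epsilon>/2 gives c/2 (\<epsilon>/2)^2 = c \<epsilon>^2/8 up to distance \<epsilon>, and the
  separation hypothesis gives \<delta> beyond.\<close>

definition \<delta>' :: real where "\<delta>' = min \<delta> (c * \<epsilon>\<^sup>2 / 8)"

lemma \<delta>'_pos: "0 < \<delta>'"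
  using pos by (simp add: \<delta>'_def)

lemma q_outer_upper:
  assumes n: "good n" and \<theta>: "\<epsilon> / 2 < \<bar>\<theta> - t n\<bar>"
  shows "q n \<theta> \<le> exp (G + B / 2) / 2 * sqrt n * exp (- real n * \<delta>') * (indicator \<Theta> \<theta> * prior \<theta>)"
proof (cases "\<theta> \<in> \<Theta>")
  case True
  have n1: "1 \<le> n" using n by (simp add: good_def)
  have "L n \<theta> / L n (t n) \<le> exp (- real n * \<delta>')"
  \<comment> \<open>Where the likelihood vanishes, \<open>avg_loglik\<close> has the default value 0
    instead of -\<infinity> and separation does not apply; the likelihood ratio is then 0.\<close>
  proof (cases "0 < L n \<theta>")
    case L: True
    have "l n \<theta> - l n (t n) \<le> - \<delta>'"
    proof (cases "\<theta> \<in> U n")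
      case U: True
      have "(\<epsilon> / 2)\<^sup>2 \<le> (\<theta> - t n)\<^sup>2" using \<theta> pos by (simp add: abs_le_square_iff[symmetric] del: power_divide)
      then have "c / 2 * (\<epsilon> / 2)\<^sup>2 \<le> c / 2 * (\<theta> - t n)\<^sup>2" using pos by (intro mult_left_mono) auto
      then have "c * \<epsilon>\<^sup>2 / 8 \<le> c / 2 * (\<theta> - t n)\<^sup>2" by (simp add: power_divide)
      then show ?thesis using l_upper[OF n1 U] by (simp add: \<delta>'_def)
    next
      case False
      then show ?thesis using separation[OF n1 _ L] True by (force simp: \<delta>'_def)
    qed
    then have "n * (l n \<theta> - l n (t n)) \<le> n * - \<delta>'" by (intro mult_left_mono) auto
    then show ?thesis by (simp add: L_ratio[OF n1 L])
  next
    case False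
    then have "L n \<theta> = 0" using L_nonneg[OF True, of n] by simp
    then show ?thesis by simp
  qed
  then show ?thesis using q_upper[OF n True] True by simp
qed (simp add: q_altdef)

text \<open>The bound on the density is a multiple of the prior, which has total mass 1, so
  integration keeps the constant even on an unbounded parameter set.\<close>

lemma outer_probability:
  assumes n: "good n"
  shows "measure (posterior \<Theta> f prior x n) (- {t n - \<epsilon> / 2 .. t n + \<epsilon> / 2})
    \<le> exp (G + B / 2) / 2 * sqrt n * exp (- real n * \<delta>')"
proof -
  let ?A = "- {t n - \<epsilon> / 2 .. t n + \<epsilon> / 2}" and ?k = "exp (G + B / 2) / 2 * sqrt n * exp (- real n * \<delta>')"
  have n1: "1 \<le> n" using n by (simp add: good_def)
  have iq: "integrable lborel (q n)"
    using kernel_integrable[OF n1] by (simp add: q_altdef[abs_def])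
  interpret prob_space "posterior \<Theta> f prior x n" by (rule prob_posterior[OF n])
  have "measure (posterior \<Theta> f prior x n) ?A = (LINT \<theta>|posterior \<Theta> f prior x n. indicator ?A \<theta>)"
    by (simp add: posterior_def)
  also have "\<dots> = (LINT \<theta>|lborel. q n \<theta> * indicator ?A \<theta>)"
    unfolding posterior_def by (subst integral_density) (auto simp: q_nonneg)
  also have "\<dots> \<le> (LINT \<theta>|lborel. ?k * (indicator \<Theta> \<theta> * prior \<theta>))"
  proof (intro integral_mono)
    show "integrable lborel (\<lambda>\<theta>. q n \<theta> * indicator ?A \<theta>)"
      using integrable_mult_indicator[OF _ iq, of ?A] by (simp add: mult.commute)
    show "integrable lborel (\<lambda>\<theta>. ?k * (indicator \<Theta> \<theta> * prior \<theta>))"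
      using prior_integral by (intro integrable_mult_right) (auto simp: has_bochner_integral_iff)
    show "q n \<theta> * indicator ?A \<theta> \<le> ?k * (indicator \<Theta> \<theta> * prior \<theta>)" for \<theta>
    proof (cases "\<theta> \<in> ?A")
      case True
      then have "\<epsilon> / 2 < \<bar>\<theta> - t n\<bar>" unfolding Compl_iff atLeastAtMost_iff by linarith
      then show ?thesis using q_outer_upper[OF n] True by simp
    qed (use prior_nonneg in \<open>auto split: split_indicator\<close>)
  qed
  also have "\<dots> = ?k"
    using prior_integral by (simp add: has_bochner_integral_iff)
  finally show ?thesis .
qed

text \<open>Because the outer probability is exponentially small, the moment can be split at an
  exponentially growing level: with R = exp(\<eta> n) both R^5 exp(-n \<delta>') and R^(5-p) decay
  exponentially, for any p > 5.\<close>

lemma tail_eventually: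
  "eventually (\<lambda>n. (LINT \<theta>:- {t n - \<epsilon> / 2 .. t n + \<epsilon> / 2}|posterior \<Theta> f prior x n. (1 + \<bar>\<theta>\<bar>) ^ 5)
     \<le> min (1 / 4) (k / real n ^ 4)) sequentially" if k: "0 < k"
proof -
  \<comment> \<open>A tenth of the gap: R^5 uses up half of it and exp(-5 \<eta> n) remains.\<close>
  define \<eta> where "\<eta> = \<delta>' / 10"
  have \<eta>: "0 < \<eta>" "\<delta>' = 10 * \<eta>" using \<delta>'_pos by (simp_all add: \<eta>_def)
  define K where "K = exp (G + B / 2) / 2"
  define Q where "Q = 2 powr p * (1 + C)"
  define \<beta> where "\<beta> = \<eta> * (p - 5)"
  have pos': "0 < K" "0 < Q" "0 < \<beta>" using pos \<eta> by (simp_all add: K_def Q_def \<beta>_def add_pos_nonneg)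
  \<comment> \<open>The exponent 0 serves the bound 1/4, the exponent 4 the bound k / n^4.\<close>
  have lim: "((\<lambda>n::nat. real n ^ i * (K * sqrt n * exp (- (5 * \<eta>) * n) + Q * exp (- \<beta> * n))) \<longlongrightarrow> 0) sequentially"
    if "i \<in> {0, 4}" for i
  proof -
    have "((\<lambda>n::nat. real n ^ i * (K * sqrt n * exp (- (5 * \<eta>) * n))) \<longlongrightarrow> 0) sequentially"
      "((\<lambda>n::nat. real n ^ i * (Q * exp (- \<beta> * n))) \<longlongrightarrow> 0) sequentially"
      using \<eta>(1) pos' that by (auto; real_asymp)+
    from tendsto_add[OF this] show ?thesis by (simp add: distrib_left)
  qed
  have "eventually (\<lambda>n::nat. K * sqrt n * exp (- (5 * \<eta>) * n) + Q * exp (- \<beta> * n) \<le> 1 / 4) sequentially"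
    using order_tendstoD(2)[OF lim[of 0], of "1 / 4"] by (auto elim!: eventually_mono)
  moreover have "eventually (\<lambda>n::nat. K * sqrt n * exp (- (5 * \<eta>) * n) + Q * exp (- \<beta> * n) \<le> k / real n ^ 4) sequentially"
    using order_tendstoD(2)[OF lim[of 4] k, simplified] eventually_gt_at_top[of 0]
    by eventually_elim (simp add: pos_le_divide_eq mult.commute)
  ultimately show ?thesis using eventually_good
  proof eventually_elim
    case (elim n)
    let ?A = "- {t n - \<epsilon> / 2 .. t n + \<epsilon> / 2}"
    have N0: "N0 \<le> n" using elim by (simp add: good_def)
    have "(LINT \<theta>:?A|posterior \<Theta> f prior x n. (1 + \<bar>\<theta>\<bar>) ^ 5)
      \<le> exp (\<eta> * n) ^ 5 * measure (posterior \<Theta> f prior x n) ?A + 2 powr p * (1 + C) * exp (\<eta> * n) powr (5 - p)"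
      by (rule fifth_moment_split(2)[OF prob_posterior[OF elim(3)] _ _ pos(7,8) moments[OF N0]])
        (use \<eta> in \<open>auto simp: posterior_def\<close>)
    also have "\<dots> \<le> exp (\<eta> * n) ^ 5 * (K * sqrt n * exp (- real n * \<delta>')) + 2 powr p * (1 + C) * exp (\<eta> * n) powr (5 - p)"
      using outer_probability[OF elim(3)] by (intro add_right_mono mult_left_mono) (auto simp: K_def)
    also have "\<dots> = K * sqrt n * exp (- (5 * \<eta>) * n) + Q * exp (- \<beta> * n)"
    proof -
      have "exp (\<eta> * n) ^ 5 * exp (- real n * \<delta>') = exp (- (5 * \<eta>) * n)"
        by (simp add: \<eta>(2) exp_of_nat_mult[symmetric] exp_add[symmetric] algebra_simps)
      moreover have "exp (\<eta> * n) powr (5 - p) = exp (- \<beta> * n)"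
        by (simp add: powr_def \<beta>_def algebra_simps)
      ultimately show ?thesis by (simp add: Q_def mult_ac)
    qed
    finally show ?case using elim(1,2) by simp
  qed
qed

section \<open>Derivatives of the log posterior and the concentration hypotheses\<close>

definition D :: "nat \<Rightarrow> nat \<Rightarrow> real \<Rightarrow> real" where
  "D n j \<theta> = n * (deriv ^^ Suc j) (l n) \<theta> + (deriv ^^ Suc j) lp \<theta>"

lemma q_has_derivative:
  assumes n: "1 \<le> n" and \<theta>: "\<theta> \<in> U n"
  shows "(q n has_real_derivative D n 0 \<theta> * q n \<theta>) (at \<theta>)"
proof -
  have eq: "q n u = exp (n * l n u + lp u) / Z n" if "u \<in> U n" for u
    using U_pos[OF n that] n by (simp add: q_altdef L_exp[of n u] exp_add)
  have "((\<lambda>u. exp (n * l n u + lp u) / Z n) has_real_derivative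
      exp (n * l n \<theta> + lp \<theta>) * (n * deriv (l n) \<theta> + deriv lp \<theta>) / Z n) (at \<theta>)"
  proof -
    have *: "((\<lambda>u. exp (n * g u + h u) / Z n) has_real_derivative
        exp (n * g \<theta> + h \<theta>) * (n * g' + h') / Z n) (at \<theta>)"
      if "(g has_real_derivative g') (at \<theta>)" "(h has_real_derivative h') (at \<theta>)" for g h :: "real \<Rightarrow> real" and g' h' :: real
      by (rule DERIV_cdivide) (auto intro!: derivative_eq_intros that)
    show ?thesis
      by (rule *[where g = "l n" and h = lp]) (use Ck_on_has_derivative[OF loglik_smooth[OF n] _ \<theta>, of 0]
        Ck_on_has_derivative[OF logprior_smooth[OF n] _ \<theta>, of 0] in simp_all)
  qed
  then have "((\<lambda>u. exp (n * l n u + lp u) / Z n) has_real_derivative D n 0 \<theta> * q n \<theta>) (at \<theta>)"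
    by (simp add: eq[OF \<theta>] D_def mult.commute)
  \<comment> \<open>The exponential form of \<open>q n\<close> holds only on the open set
    \<open>U n\<close>, which suffices for a derivative at one of its points.\<close>
  then show ?thesis
    by (rule has_field_derivative_transform_within_open[of _ _ _ "U n"]) (use \<theta> eq in \<open>auto simp: U_def\<close>)
qed

lemma D_has_derivative:
  assumes n: "1 \<le> n" and \<theta>: "\<theta> \<in> U n" and j: "j < 4"
  shows "(D n j has_real_derivative D n (Suc j) \<theta>) (at \<theta>)"
  unfolding D_def
  by (intro DERIV_add DERIV_cmult Ck_on_has_derivative[OF loglik_smooth[OF n] _ \<theta>]
      Ck_on_has_derivative[OF logprior_smooth[OF n] _ \<theta>]) (use j in auto)

text \<open>The log prior contributes a bounded term, absorbed since n is at least 1. The added 1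
  keeps the constant positive, as the locale of concentrating densities demands, even if
  \<open>B\<close> and \<open>G\<close> vanish.\<close>

lemma D_bound:
  assumes n: "1 \<le> n" "N0 \<le> n" and \<theta>: "\<bar>\<theta> - t n\<bar> \<le> \<epsilon> / 2" and j: "j \<le> 4"
  shows "\<bar>D n j \<theta>\<bar> \<le> (B + G + 1) * n"
proof -
  have "\<bar>n * (deriv ^^ Suc j) (l n) \<theta>\<bar> \<le> n * B"
    unfolding abs_mult using loglik_deriv_le[OF n(2) half_subset[OF \<theta>], of "Suc j"] j
    by (intro mult_mono) auto
  moreover have "\<bar>(deriv ^^ Suc j) lp \<theta>\<bar> \<le> G"
    using j by (intro logprior_deriv_le[OF n(1) _ \<theta>]) auto
  moreover have "1 * (G + 1) \<le> n * (G + 1)" using n pos by (intro mult_right_mono) auto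
  ultimately show ?thesis unfolding D_def by (simp add: algebra_simps)
qed

lemma posterior_cumulants:
  "(\<lambda>n. invariant_cumulant (posterior \<Theta> f prior x n) 3) \<in> O(\<lambda>n. 1 / sqrt n)"
  "(\<lambda>n. invariant_cumulant (posterior \<Theta> f prior x n) 4) \<in> O(\<lambda>n. (1 / sqrt n) ^ 2)"
  "(\<lambda>n. invariant_cumulant (posterior \<Theta> f prior x n) 5) \<in> O(\<lambda>n. (1 / sqrt n) ^ 3)"
proof -
  define K where "K = exp (2 * G + B / 2) / 2 * sqrt (2 * pi) / sqrt c"
  have K: "0 < K" using pos by (simp add: K_def)
  obtain N where N: "\<And>n. N \<le> n \<Longrightarrow> good n"
    "\<And>n. N \<le> n \<Longrightarrow> (LINT \<theta>:- {t n - \<epsilon> / 2 .. t n + \<epsilon> / 2}|posterior \<Theta> f prior x n. (1 + \<bar>\<theta>\<bar>) ^ 5)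
     \<le> min (1 / 4) (K / real n ^ 4)"
    using eventually_conj[OF eventually_good tail_eventually[OF K]] unfolding eventually_sequentially by blast
  have n: "1 \<le> n" "N0 \<le> n" if "N \<le> n" for n using N(1)[OF that] by (auto simp: good_def)
  have abs: "\<bar>\<theta> - t n\<bar> \<le> \<epsilon> / 2" if "\<theta> \<in> {t n - \<epsilon> / 2 .. t n + \<epsilon> / 2}" for \<theta> n
    using that unfolding atLeastAtMost_iff by linarith
  note post = posterior_def[symmetric]
  \<comment> \<open>The radius is \<epsilon>/2 because the prior is controlled there, and the scale
    1 / sqrt c comes from the curvature bound.\<close>
  have *: "concentrating_densities q t D (\<epsilon> / 2) K (1 / sqrt c) (B + G + 1) T N"
  proof (rule concentrating_densities.intro, unfold post)
    show "0 < N" using n(1)[of N] by simp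
    show "q n \<theta> \<le> K * normal_density (t n) (1 / sqrt c / sqrt n) \<theta>"
      if "N \<le> n" "\<theta> \<in> {t n - \<epsilon> / 2 .. t n + \<epsilon> / 2}" for n \<theta>
      unfolding K_def by (rule q_local_upper[OF N(1)[OF that(1)] abs[OF that(2)]])
    \<comment> \<open>The score vanishes at the maximizer, so the term of order n drops out and only
      the derivative of the log prior is left.\<close>
    show "\<bar>D n 0 (t n)\<bar> \<le> B + G + 1" if "N \<le> n" for n
      using logprior_deriv_le[OF n(1)[OF that], of 1 "t n"] pos score_zero[OF n(1)[OF that]] by (simp add: D_def)
    show "integrable (posterior \<Theta> f prior x n) (\<lambda>\<theta>. (1 + \<bar>\<theta>\<bar>) ^ 5)" if "N \<le> n" for n
      by (rule fifth_moment_split(1)[OF prob_posterior[OF N(1)[OF that]] _ _ pos(7,8) moments[OF n(2)[OF that]], of "{}" 1])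
        (auto simp: posterior_def)
    show "prob_space (posterior \<Theta> f prior x n)" if "N \<le> n" for n
      by (rule prob_posterior[OF N(1)[OF that]])
    show "(q n has_real_derivative D n 0 \<theta> * q n \<theta>) (at \<theta>)"
      if "N \<le> n" "\<theta> \<in> {t n - \<epsilon> / 2 .. t n + \<epsilon> / 2}" for n \<theta>
      by (rule q_has_derivative[OF n(1)[OF that(1)] half_subset[OF abs[OF that(2)]]])
    show "(D n j has_real_derivative D n (Suc j) \<theta>) (at \<theta>)"
      if "N \<le> n" "\<theta> \<in> {t n - \<epsilon> / 2 .. t n + \<epsilon> / 2}" "j < 4" for n \<theta> j
      by (rule D_has_derivative[OF n(1)[OF that(1)] half_subset[OF abs[OF that(2)]] that(3)])
    show "\<bar>D n j \<theta>\<bar> \<le> (B + G + 1) * n"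
      if "N \<le> n" "\<theta> \<in> {t n - \<epsilon> / 2 .. t n + \<epsilon> / 2}" "j \<in> {1..4}" for n \<theta> j
      using D_bound[OF n[OF that(1)] abs[OF that(2)]] that(3) by simp
    show "\<bar>t n\<bar> \<le> T" if "N \<le> n" for n
      by (rule t_le[OF n(1)[OF that]])
    show "(LINT \<theta>:- {t n - \<epsilon> / 2 .. t n + \<epsilon> / 2}|posterior \<Theta> f prior x n. (1 + \<bar>\<theta>\<bar>) ^ 5)
      \<le> min (1 / 4) (K / real n ^ 4)" if "N \<le> n" for n
      by (rule N(2)[OF that])
  qed (use pos K q_nonneg in simp_all)
  interpret concentrating_densities q t D "\<epsilon> / 2" K "1 / sqrt c" "B + G + 1" T N
    "\<lambda>n. density lborel (\<lambda>\<theta>. ennreal (q n \<theta>))" "\<lambda>n. {t n - \<epsilon> / 2 .. t n + \<epsilon> / 2}"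
    "\<lambda>n. mean (density lborel (\<lambda>\<theta>. ennreal (q n \<theta>)))" "\<lambda>n. std_dev (density lborel (\<lambda>\<theta>. ennreal (q n \<theta>)))"
    by (rule * reflexive)+
  show "(\<lambda>n. invariant_cumulant (posterior \<Theta> f prior x n) 3) \<in> O(\<lambda>n. 1 / sqrt n)"
    "(\<lambda>n. invariant_cumulant (posterior \<Theta> f prior x n) 4) \<in> O(\<lambda>n. (1 / sqrt n) ^ 2)"
    "(\<lambda>n. invariant_cumulant (posterior \<Theta> f prior x n) 5) \<in> O(\<lambda>n. (1 / sqrt n) ^ 3)"
    using invariant_cumulants unfolding posterior_def .
qed

end

theorem lemma1:
  fixes M :: "'a measure" and \<Theta> :: "real set" and f :: "'a \<Rightarrow> real \<Rightarrow> real"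
    and prior :: "real \<Rightarrow> real" and x :: "nat \<Rightarrow> 'a" and \<theta>hat :: "nat \<Rightarrow> real"
    and \<epsilon> \<delta> :: real
  defines "nbhd \<equiv> \<lambda>n. {\<theta>hat n - \<epsilon> <..< \<theta>hat n + \<epsilon>}"
  assumes model: "bayes_model M \<Theta> f prior"
    and data: "\<forall>i\<ge>1. x i \<in> space M"
    and maximizer: "\<forall>n\<ge>1. unique_global_maximizer (likelihood f x n) \<Theta> (\<theta>hat n)"
    and eps: "\<epsilon> > 0" and delta: "\<delta> > 0"
    and logs_defined:
      "\<forall>n\<ge>1. nbhd n \<subseteq> \<Theta> \<and> (\<forall>\<theta>\<in>nbhd n. likelihood f x n \<theta> > 0 \<and> prior \<theta> > 0)"
    and smooth:
      "\<forall>n\<ge>1. Ck_on 6 (avg_loglik f x n) (nbhd n) \<and> Ck_on 6 (\<lambda>\<theta>. ln (prior \<theta>)) (nbhd n)"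
    and separation:
      "\<forall>n\<ge>1. \<forall>\<theta>\<in>\<Theta> - nbhd n. likelihood f x n \<theta> > 0 \<longrightarrow>
         avg_loglik f x n \<theta> < avg_loglik f x n (\<theta>hat n) - \<delta>"
    and second_derivative:
      "\<exists>c>0. \<forall>n\<ge>1. \<forall>\<theta>\<in>nbhd n. \<bar>(deriv ^^ 2) (avg_loglik f x n) \<theta>\<bar> \<ge> c"
    and well_behaved_maximizers: "bounded (\<theta>hat ` {1..})"
    and well_behaved_derivatives:
      "\<exists>B. \<forall>\<^sub>F n in sequentially. \<forall>\<theta>\<in>nbhd n. \<forall>j\<in>{1..6}.
         \<bar>(deriv ^^ j) (avg_loglik f x n) \<theta>\<bar> \<le> B"
    and well_behaved_moments:
      "\<exists>p>5. \<exists>C. \<forall>\<^sub>F n in sequentially.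
         (\<integral>\<^sup>+\<theta>. ennreal (\<bar>\<theta>\<bar> powr p) \<partial>posterior \<Theta> f prior x n) \<le> ennreal C"
    and bernstein_von_mises:
      "(\<lambda>n. tv_dist (standardized (posterior \<Theta> f prior x n)) std_normal_distribution)
         \<longlonglongrightarrow> 0"
  shows "\<forall>j\<in>{3, 4, 5}. (\<lambda>n. invariant_cumulant (posterior \<Theta> f prior x n) j)
           \<in> O(\<lambda>n. real n powr ((2 - real j) / 2))"
proof -
  interpret bayes_model M \<Theta> f prior by (rule model)
  obtain c where c: "0 < c" "\<And>n \<theta>. 1 \<le> n \<Longrightarrow> \<theta> \<in> nbhd n \<Longrightarrow> c \<le> \<bar>(deriv ^^ 2) (avg_loglik f x n) \<theta>\<bar>"
    using second_derivative by blast
  obtain B where "\<forall>\<^sub>F n in sequentially. \<forall>\<theta>\<in>nbhd n. \<forall>j\<in>{1..6}. \<bar>(deriv ^^ j) (avg_loglik f x n) \<theta>\<bar> \<le> B"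
    using well_behaved_derivatives by blast
  moreover obtain p C where p: "5 < p"
    "\<forall>\<^sub>F n in sequentially. (\<integral>\<^sup>+\<theta>. ennreal (\<bar>\<theta>\<bar> powr p) \<partial>posterior \<Theta> f prior x n) \<le> ennreal C"
    using well_behaved_moments by blast
  ultimately obtain N0 where N0:
    "\<And>n \<theta> j. N0 \<le> n \<Longrightarrow> \<theta> \<in> nbhd n \<Longrightarrow> j \<in> {1..6} \<Longrightarrow> \<bar>(deriv ^^ j) (avg_loglik f x n) \<theta>\<bar> \<le> B"
    "\<And>n. N0 \<le> n \<Longrightarrow> (\<integral>\<^sup>+\<theta>. ennreal (\<bar>\<theta>\<bar> powr p) \<partial>posterior \<Theta> f prior x n) \<le> ennreal C"
    using eventually_conj[OF _ p(2)] unfolding eventually_sequentially by metis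
  obtain T where T: "0 < T" "\<And>n. 1 \<le> n \<Longrightarrow> \<bar>\<theta>hat n\<bar> \<le> T"
    using well_behaved_maximizers unfolding bounded_pos by auto
  obtain G where G: "0 \<le> G" "\<And>n j \<theta>. n \<in> {1..} \<Longrightarrow> j \<le> 6 \<Longrightarrow> \<bar>\<theta> - \<theta>hat n\<bar> \<le> \<epsilon> / 2 \<Longrightarrow>
      \<bar>(deriv ^^ j) (\<lambda>\<theta>. ln (prior \<theta>)) \<theta>\<bar> \<le> G"
    using uniform_derivative_bound[OF eps well_behaved_maximizers, of 6 "\<lambda>\<theta>. ln (prior \<theta>)"] smooth
    unfolding nbhd_def by auto
  \<comment> \<open>The bounds obtained from the hypotheses carry no sign, so \<open>B\<close> and
    \<open>C\<close> are replaced by their maxima with 0.\<close>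
  interpret regular_posterior M \<Theta> f prior x \<theta>hat \<epsilon> \<delta> c "max B 0" G T p "max C 0" N0 nbhd
  proof (unfold_locales)
    show "\<bar>(deriv ^^ j) (avg_loglik f x n) \<theta>\<bar> \<le> max B 0"
      if "N0 \<le> n" "\<theta> \<in> {\<theta>hat n - \<epsilon><..<\<theta>hat n + \<epsilon>}" "j \<in> {1..6}" for n \<theta> j
      using N0(1)[of n \<theta> j] that by (simp add: nbhd_def)
    show "(\<integral>\<^sup>+\<theta>. ennreal (\<bar>\<theta>\<bar> powr p) \<partial>posterior \<Theta> f prior x n) \<le> ennreal (max C 0)" if "N0 \<le> n" for n
      using N0(2)[OF that] by (rule order_trans) (auto intro: ennreal_leI)
    show "\<theta> \<in> \<Theta> \<and> 0 < likelihood f x n \<theta> \<and> 0 < prior \<theta>"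
      if "1 \<le> n" "\<theta> \<in> {\<theta>hat n - \<epsilon><..<\<theta>hat n + \<epsilon>}" for n \<theta>
      using logs_defined that unfolding nbhd_def by blast
  qed (use data maximizer eps delta c G T p smooth separation in \<open>auto simp: nbhd_def\<close>)
  \<comment> \<open>For j = 3, 4, 5 the exponent (2 - j)/2 is -1/2, -1, -3/2, that is the power j -
    2 of 1 / sqrt n.\<close>
  have e: "(\<lambda>n. 1 / sqrt (real n)) \<in> O(\<lambda>n. real n powr ((2 - real 3) / 2))"
    "(\<lambda>n. (1 / sqrt (real n)) ^ 2) \<in> O(\<lambda>n. real n powr ((2 - real 4) / 2))"
    "(\<lambda>n. (1 / sqrt (real n)) ^ 3) \<in> O(\<lambda>n. real n powr ((2 - real 5) / 2))"
    by (simp, real_asymp)+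
  show ?thesis
    using landau_o.big_trans[OF posterior_cumulants(1) e(1)] landau_o.big_trans[OF posterior_cumulants(2) e(2)]
      landau_o.big_trans[OF posterior_cumulants(3) e(3)]
    by simp
qed

end
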